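(* Let $n$ be an odd positive integer, let $d,e$ be positive integers with $\gcd(n,d)=\gcd(n,e)=1$, and let $q=2^n$. For $k\in\{d,e\}$ let $\mathcal{O}_k=\{(y^{2^k}+y,\,y): y\in\mathbb{F}_q\}\cup\{(0),(1)\}$, a hyperoval in $\Pi(\mathbb{K}_n^{td})$. Then $\mathcal{O}_d$ and $\mathcal{O}_e$ are equivalent if and only if $d\equiv\pm e\pmod n$.
   Context: $\mathrm{Tr}:\mathbb{F}_q\to\mathbb{F}_2$ is the absolute trace. $\mathbb{K}_n^{td}=(\mathbb{F}_q,+,\circ)$ ($n$ odd) is the presemifield with $x\circ y=xy+\mathrm{Tr}(x)\,y^{2^{n-1}}+\mathrm{Tr}(x^2y)$. The plane $\Pi(\mathbb{K}_n^{td})$ has affine points $(a,b)$, $a,b\in\mathbb{F}_q$, points at infinity $(a)$, $a\in\mathbb{F}_q\cup\{\infty\}$, and lines: the line at infinity (all points $(a)$); $l_a=\{(a,y):y\in\mathbb{F}_q\}\cup\{(\infty)\}$ for $a\in\mathbb{F}_q$; $l_{a,b}=\{(x,y):y=x\circ a+b\}\cup\{(a)\}$ for $a,b\in\mathbb{F}_q$. Two hyperovals are equivalent if some collineation of the plane maps one onto the other. *)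

theory Defs
  imports "HOL-Library.Cardinality" "HOL-Number_Theory.Cong"
begin

(* Throughout, 'a is a finite field with 2^n elements, and n is passed explicitly.
   The subfield F_2 is identified with {0, 1} in 'a, so the trace takes values in 'a. *)

definition abs_trace :: "nat \<Rightarrow> 'a::field \<Rightarrow> 'a" where
  "abs_trace n x = (\<Sum>i<n. x ^ (2 ^ i))"

definition td_mult :: "nat \<Rightarrow> 'a::field \<Rightarrow> 'a \<Rightarrow> 'a" where
  "td_mult n x y = x * y + abs_trace n x * y ^ (2 ^ (n - 1)) + abs_trace n (x ^ 2 * y)"

(* Aff a b is the affine point (a, b); Ideal a is the point (a) and Ideal_infty the
   point (\<infinity>) at infinity. All elements of the type are points of the plane. *)

datatype 'a point = Aff 'a 'a | Ideal 'a | Ideal_infty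

definition line_infty :: "'a point set" where
  "line_infty = range Ideal \<union> {Ideal_infty}"

definition vert_line :: "'a \<Rightarrow> 'a point set" where
  "vert_line a = {Aff a y | y. True} \<union> {Ideal_infty}"

definition td_line :: "nat \<Rightarrow> 'a::field \<Rightarrow> 'a \<Rightarrow> 'a point set" where
  "td_line n a b = {Aff x y | x y. y = td_mult n x a + b} \<union> {Ideal a}"

definition td_plane_lines :: "nat \<Rightarrow> 'a::field point set set" where
  "td_plane_lines n =
     {line_infty} \<union> range vert_line \<union> {td_line n a b | a b. True}"

(* Incidence structures are given by their set of lines; 'p is the type of points. *)

definition collineation :: "'p set set \<Rightarrow> ('p \<Rightarrow> 'p) \<Rightarrow> bool" where
  "collineation L f \<longleftrightarrow> bij f \<and> (\<forall>l. f ` l \<in> L \<longleftrightarrow> l \<in> L)"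

(* A hyperoval of a plane of order q: q + 2 points, no three of them collinear. *)

definition hyperoval :: "'p set set \<Rightarrow> nat \<Rightarrow> 'p set \<Rightarrow> bool" where
  "hyperoval L q S \<longleftrightarrow> finite S \<and> card S = q + 2 \<and>
     (\<forall>x\<in>S. \<forall>y\<in>S. \<forall>z\<in>S. x \<noteq> y \<and> x \<noteq> z \<and> y \<noteq> z \<longrightarrow>
        \<not> (\<exists>l\<in>L. x \<in> l \<and> y \<in> l \<and> z \<in> l))"

definition equivalent_in :: "'p set set \<Rightarrow> 'p set \<Rightarrow> 'p set \<Rightarrow> bool" where
  "equivalent_in L S T \<longleftrightarrow> (\<exists>f. collineation L f \<and> f ` S = T)"

definition td_hyperoval :: "nat \<Rightarrow> 'a::field point set" where
  "td_hyperoval k = {Aff (y ^ (2 ^ k) + y) y | y. True} \<union> {Ideal 0, Ideal 1}"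

end

theory Submission
  imports Defs "HOL-Computational_Algebra.Polynomial"
begin

text \<open>
  The affine part of the hyperoval is an additive group, so its secants correspond to nonzero
  solutions of p = (p^(2^k) + p) \<star> a, and every slope a has at most one of these. If
  d + e is divisible by n, the shear (x, y) \<mapsto> (x, y + x) swaps (0) and (1) and maps one
  hyperoval onto the other.

  Conversely let n \<ge> 5. A collineation moving the line at infinity would make an affine vertical
  line the axis of a translation group, and one moving (\<infinity>) would yield shears centred
  at (0); both are excluded by counting the zeros of polynomials with few terms. Up to a shear and
  a translation, an equivalence of the hyperovals is therefore (x, y) \<mapsto> (A x, A y)
  with A additive, A (x \<star> a) = A x \<star> N a and A (y^(2^d)) = (A y)^(2^e). Hence A preserves the
  kernel H of the trace. On H, the function N is proportional to A, because A (x y) is symmetric;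
  so A (x^2) agrees with c (A x)^2 up to an element of the prime field. But A transports
  the squaring map to x \<mapsto> x^(2^m) with m d = e modulo n, and x^(2^m) = c x^2 has
  too many solutions unless m = 1 modulo n.
\<close>

section \<open>Counting zeros of polynomials and kernels of additive maps\<close>

lemma card_poly_zeros_le:
  fixes p :: "'a::{comm_ring_1,ring_no_zero_divisors} poly"
  assumes "p \<noteq> 0" and "degree p \<le> m" and "\<And>x. x \<in> A \<Longrightarrow> poly p x = 0"
  shows "card A \<le> m"
proof -
  have "card A \<le> card {x. poly p x = 0}"
    using assms by (intro card_mono poly_roots_finite) auto
  then show ?thesis
    using card_poly_roots_bound[OF assms(1)] assms(2) by linarith
qed

text \<open>If some k in K takes the value c, then K is covered by the kernel and its translate by
  k, so the kernel has index at most 2. It is applied to conditions that hold up to an element of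
  the prime field (a bit).\<close>

lemma card_additive_le:
  fixes K :: "'a::ab_group_add set" and \<phi> :: "'a \<Rightarrow> 'b::ab_group_add"
  assumes "finite K" and sub: "\<And>x y. x \<in> K \<Longrightarrow> y \<in> K \<Longrightarrow> x - y \<in> K"
    and add: "\<And>x y. x \<in> K \<Longrightarrow> y \<in> K \<Longrightarrow> \<phi> (x - y) = \<phi> x - \<phi> y"
    and val: "\<And>x. x \<in> K \<Longrightarrow> \<phi> x = 0 \<or> \<phi> x = c"
  shows "card K \<le> 2 * card {x \<in> K. \<phi> x = 0}"
proof (cases "\<exists>k\<in>K. \<phi> k = c")
  case False
  then have "{x \<in> K. \<phi> x = 0} = K" using val by auto
  then show ?thesis by simp
next
  case True
  then obtain k where k: "k \<in> K" "\<phi> k = c" by auto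
  let ?Z = "{x \<in> K. \<phi> x = 0}"
  have "K \<subseteq> ?Z \<union> (\<lambda>z. z + k) ` ?Z"
  proof
    fix x assume x: "x \<in> K"
    consider "\<phi> x = 0" | "\<phi> x = c" using val[OF x] by auto
    then show "x \<in> ?Z \<union> (\<lambda>z. z + k) ` ?Z"
    proof cases
      case 2
      then have "x - k \<in> ?Z" using k x by (auto simp: add sub)
      then show ?thesis by (auto intro!: image_eqI[of _ _ "x - k"])
    qed (use x in auto)
  qed
  then have "card K \<le> card (?Z \<union> (\<lambda>z. z + k) ` ?Z)"
    using assms(1) by (intro card_mono) auto
  also have "\<dots> \<le> card ?Z + card ((\<lambda>z. z + k) ` ?Z)" by (rule card_Un_le)
  also have "card ((\<lambda>z. z + k) ` ?Z) \<le> card ?Z" using assms(1) by (intro card_image_le) auto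
  finally show ?thesis by simp
qed

subsection \<open>Central collineations\<close>

lemma collineationI:
  assumes "\<And>p. g (f p) = p" "\<And>p. f (g p) = p"
    and "\<And>l. l \<in> L \<Longrightarrow> f ` l \<in> L" "\<And>l. l \<in> L \<Longrightarrow> g ` l \<in> L"
  shows "collineation L f"
proof -
  have "g ` (f ` l) = l" for l by (simp add: image_image assms(1))
  then show ?thesis
    unfolding collineation_def using assms
    by (metis bij_iff)
qed

lemma collineation_bij: "collineation L f \<Longrightarrow> bij f"
  by (simp add: collineation_def)

lemma collineation_image: "collineation L f \<Longrightarrow> l \<in> L \<Longrightarrow> f ` l \<in> L"
  by (simp add: collineation_def)

lemma collineation_mem: "collineation L f \<Longrightarrow> f p \<in> f ` l \<longleftrightarrow> p \<in> l"
  by (simp add: collineation_bij bij_is_inj inj_image_mem_iff)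

lemma collineation_comp: "collineation L f \<Longrightarrow> collineation L g \<Longrightarrow> collineation L (f \<circ> g)"
  unfolding collineation_def by (metis bij_comp image_comp)

lemma collineation_inv:
  assumes "collineation L f" shows "collineation L (inv f)"
proof -
  have b: "bij f" using assms by (rule collineation_bij)
  have "f ` (inv f ` l) = l" for l using b by (simp add: bij_is_surj image_f_inv_f)
  then show ?thesis using assms bij_imp_bij_inv[OF b] unfolding collineation_def by metis
qed

definition central_collineation :: "'p set set \<Rightarrow> 'p \<Rightarrow> 'p set \<Rightarrow> ('p \<Rightarrow> 'p) \<Rightarrow> bool" where
  "central_collineation L P l g \<longleftrightarrow>
     collineation L g \<and> (\<forall>X\<in>l. g X = X) \<and> (\<forall>k\<in>L. P \<in> k \<longrightarrow> g ` k = k)"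

text \<open>(P, l)-transitivity for every centre P on l: with l taken as the line at infinity, the
  translations are transitive on the affine points.\<close>

definition translation_line :: "'p set set \<Rightarrow> 'p set \<Rightarrow> bool" where
  "translation_line L l \<longleftrightarrow> (\<forall>P\<in>l. \<forall>k\<in>L. \<forall>A\<in>k. \<forall>B\<in>k. P \<in> k \<longrightarrow> A \<notin> l \<longrightarrow> B \<notin> l \<longrightarrow>
     (\<exists>g. central_collineation L P l g \<and> g A = B))"

text \<open>The dual condition, with centre P fixed and the axis l varying through P. Transitivity
  is tested only on the points of the line m, which is all that is needed to move one point at
  infinity to another.\<close>

definition shear_point :: "'p set set \<Rightarrow> 'p set \<Rightarrow> 'p \<Rightarrow> bool" where
  "shear_point L m P \<longleftrightarrow> (\<forall>l\<in>L. \<forall>A\<in>m. \<forall>B\<in>m. P \<in> l \<longrightarrow> l \<noteq> m \<longrightarrow> A \<noteq> P \<longrightarrow> B \<noteq> P \<longrightarrow>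
     (\<exists>g. central_collineation L P l g \<and> g A = B))"

lemma translation_lineD:
  assumes "translation_line L l" "P \<in> l" "k \<in> L" "P \<in> k" "A \<in> k" "B \<in> k" "A \<notin> l" "B \<notin> l"
  obtains g where "central_collineation L P l g" "g A = B"
  using assms unfolding translation_line_def by meson

lemma shear_pointD:
  assumes "shear_point L m P" "l \<in> L" "P \<in> l" "l \<noteq> m" "A \<in> m" "B \<in> m" "A \<noteq> P" "B \<noteq> P"
  obtains g where "central_collineation L P l g" "g A = B"
  using assms unfolding shear_point_def by meson

lemma central_collineation_conjugate:
  assumes f: "collineation L f" and g: "central_collineation L P l g"
  shows "central_collineation L (f P) (f ` l) (f \<circ> g \<circ> inv f)"
  unfolding central_collineation_def
proof (intro conjI ballI impI)
  have invf: "inv f (f x) = x" "f (inv f x) = x" for x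
    using collineation_bij[OF f] by (simp_all add: bij_is_inj bij_is_surj surj_f_inv_f)
  show "collineation L (f \<circ> g \<circ> inv f)"
    using f g by (intro collineation_comp collineation_inv) (simp_all add: central_collineation_def)
  show "(f \<circ> g \<circ> inv f) X = X" if "X \<in> f ` l" for X
    using that g by (auto simp: central_collineation_def invf)
  show "(f \<circ> g \<circ> inv f) ` k = k" if "k \<in> L" "f P \<in> k" for k
  proof -
    have "inv f ` k \<in> L" using that f collineation_image collineation_inv by metis
    moreover have "P \<in> inv f ` k" using that(2) invf(1) by (metis imageI)
    ultimately have "g ` (inv f ` k) = inv f ` k" using g by (auto simp: central_collineation_def)
    moreover have "(f \<circ> g \<circ> inv f) ` k = f ` (g ` (inv f ` k))" by (simp only: image_comp comp_assoc)
    ultimately have "(f \<circ> g \<circ> inv f) ` k = f ` (inv f ` k)" by simp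
    then show ?thesis by (simp add: image_image invf)
  qed
qed

text \<open>Conjugation by f moves centre and axis by f. So a collineation that moved the line at
  infinity would produce a second translation line.\<close>

lemma translation_line_image:
  assumes f: "collineation L f" and l: "translation_line L l"
  shows "translation_line L (f ` l)"
  unfolding translation_line_def
proof (intro ballI impI)
  fix P k A B
  assume *: "P \<in> f ` l" "k \<in> L" "A \<in> k" "B \<in> k" "P \<in> k" "A \<notin> f ` l" "B \<notin> f ` l"
  have invf: "inv f (f x) = x" "f (inv f x) = x" for x
    using collineation_bij[OF f] by (simp_all add: bij_is_inj bij_is_surj surj_f_inv_f)
  have "inv f P \<in> l" using *(1) by (auto simp: invf)
  moreover have "inv f ` k \<in> L" using * f collineation_image collineation_inv by metis
  moreover have "inv f A \<notin> l" "inv f B \<notin> l" using *(6,7) invf(2) by (metis imageI)+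
  ultimately obtain g where g: "central_collineation L (inv f P) l g" "g (inv f A) = inv f B"
    using translation_lineD[OF l, of "inv f P" "inv f ` k" "inv f A" "inv f B"] *(3-5) by blast
  have "central_collineation L P (f ` l) (f \<circ> g \<circ> inv f)"
    using central_collineation_conjugate[OF f g(1)] by (simp add: invf)
  moreover have "(f \<circ> g \<circ> inv f) A = B" by (simp add: g(2) invf)
  ultimately show "\<exists>g. central_collineation L P (f ` l) g \<and> g A = B" by blast
qed

lemma shear_point_image:
  assumes f: "collineation L f" and m: "f ` m = m" and P: "shear_point L m P"
  shows "shear_point L m (f P)"
  unfolding shear_point_def
proof (intro ballI impI)
  fix l A B
  assume *: "l \<in> L" "A \<in> m" "B \<in> m" "f P \<in> l" "l \<noteq> m" "A \<noteq> f P" "B \<noteq> f P"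
  have invf: "inv f (f x) = x" "f (inv f x) = x" for x
    using collineation_bij[OF f] by (simp_all add: bij_is_inj bij_is_surj surj_f_inv_f)
  have finv: "f ` (inv f ` l) = l" by (simp add: image_image invf)
  have "inv f ` l \<in> L" using * f collineation_image collineation_inv by metis
  moreover have "P \<in> inv f ` l" using *(4) invf(1) by (metis imageI)
  moreover have "inv f ` l \<noteq> m" using finv m *(5) by metis
  moreover have "inv f A \<in> m" "inv f B \<in> m" using *(2,3) m invf(1) by (metis imageE)+
  moreover have "inv f A \<noteq> P" "inv f B \<noteq> P" using *(6,7) invf(2) by metis+
  ultimately obtain g where g: "central_collineation L P (inv f ` l) g" "g (inv f A) = inv f B"
    using shear_pointD[OF P, of "inv f ` l" "inv f A" "inv f B"] by blast
  have "central_collineation L (f P) l (f \<circ> g \<circ> inv f)"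
    using central_collineation_conjugate[OF f g(1)] by (simp add: finv)
  moreover have "(f \<circ> g \<circ> inv f) A = B" by (simp add: g(2) invf)
  ultimately show "\<exists>g. central_collineation L (f P) l g \<and> g A = B" by blast
qed

section \<open>Incidence in coordinates\<close>

lemma mem_lines [simp]:
  "Aff x y \<notin> line_infty" "Ideal c \<in> line_infty" "Ideal_infty \<in> line_infty"
  "Aff x y \<in> vert_line a \<longleftrightarrow> x = a" "Ideal c \<notin> vert_line a" "Ideal_infty \<in> vert_line a"
  "Aff x y \<in> td_line n a b \<longleftrightarrow> y = td_mult n x a + b"
  "Ideal c \<in> td_line n a b \<longleftrightarrow> c = a" "Ideal_infty \<notin> td_line n a b"
  by (auto simp: line_infty_def vert_line_def td_line_def)

lemma lines_in_plane [simp]: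
  "line_infty \<in> td_plane_lines n" "vert_line a \<in> td_plane_lines n" "td_line n a b \<in> td_plane_lines n"
  by (auto simp: td_plane_lines_def)

lemma plane_line_cases:
  assumes "l \<in> td_plane_lines n"
  obtains "l = line_infty" | a where "l = vert_line a" | a b where "l = td_line n a b"
  using assms by (auto simp: td_plane_lines_def)

lemma line_through_infty:
  assumes "l \<in> td_plane_lines n" "Ideal_infty \<in> l" "Aff x y \<in> l"
  shows "l = vert_line x"
  using assms by (elim plane_line_cases) simp_all

lemma mem_td_hyperoval [simp]:
  "Aff x y \<in> td_hyperoval k \<longleftrightarrow> x = y ^ (2 ^ k) + y"
  "Ideal c \<in> td_hyperoval k \<longleftrightarrow> c = 0 \<or> c = 1" "Ideal_infty \<notin> td_hyperoval k"
  by (auto simp: td_hyperoval_def)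

subsection \<open>Finite fields of odd degree over the prime field of order 2\<close>

locale odd_binary_field =
  fixes n :: nat and ty :: "'a::{field, finite} itself"
  assumes odd_n: "odd n" and card_UNIV: "CARD('a) = 2 ^ n"
begin

lemma n_pos: "n > 0"
  using odd_n by (rule odd_pos)

text \<open>Translation by 1 permutes the field, so comparing the sums of all elements gives 2^n = 0
  in the field, and hence 2 = 0.\<close>

lemma char_two: "CHAR('a) = 2"
proof -
  have "(\<Sum>x\<in>(UNIV :: 'a set). x) = (\<Sum>x\<in>UNIV. x + 1)"
    by (rule sum.reindex_bij_witness[of _ "\<lambda>y. y + 1" "\<lambda>y. y - 1"]) auto
  then have "of_nat CARD('a) = (0 :: 'a)"
    by (simp add: sum.distrib)
  then have "(2 :: 'a) ^ n = 0"
    by (simp add: card_UNIV)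
  then have "(of_nat 2 :: 'a) = 0" by simp
  then have "CHAR('a) dvd 2" by (simp only: of_nat_eq_0_iff_char_dvd)
  then show ?thesis
    using CHAR_not_1 by (metis One_nat_def dvd_antisym dvd_refl one_dvd prime_nat_iff two_is_prime_nat)
qed

lemma add_self [simp]: "x + x = (0 :: 'a)"
  using minus_CHAR_2[OF char_two, of x x] by simp

lemma add_self_left [simp]: "x + (x + y) = (y :: 'a)"
  by (simp flip: add.assoc)

lemma uminus_eq [simp]: "- x = (x :: 'a)"
  by (rule uminus_CHAR_2[OF char_two])

lemma diff_eq [simp]: "x - y = x + (y :: 'a)"
  by (rule minus_CHAR_2[OF char_two])

lemma two_eq_zero [simp]: "(2 :: 'a) = 0"
  using add_self[of 1] by (simp only: one_add_one)

lemma add_eq_zero_iff: "x + y = 0 \<longleftrightarrow> x = (y :: 'a)"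
  using eq_iff_diff_eq_0[of x y] by simp

lemma frob_add: "(x + y :: 'a) ^ (2 ^ k) = x ^ (2 ^ k) + y ^ (2 ^ k)"
  by (rule freshmans_dream') (simp_all add: char_two)

lemma square_add: "(x + y :: 'a)\<^sup>2 = x\<^sup>2 + y\<^sup>2"
  using frob_add[of x y 1] by simp

lemma square_inject: "x\<^sup>2 = y\<^sup>2 \<longleftrightarrow> x = (y :: 'a)"
  using square_add[of x y] by (auto simp: add_eq_zero_iff)

lemma frob_inject: "x ^ (2 ^ k) = y ^ (2 ^ k) \<longleftrightarrow> x = (y :: 'a)"
  using frob_add[of x y k] by (auto simp: add_eq_zero_iff)

lemma power_q [simp]: "(x :: 'a) ^ (2 ^ n) = x"
proof (cases "x = 0")
  case False
  let ?P = "\<Prod>y\<in>UNIV - {0 :: 'a}. y"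
  have "?P = (\<Prod>y\<in>UNIV - {0}. x * y)"
    by (rule prod.reindex_bij_witness[of _ "\<lambda>y. x * y" "\<lambda>y. y / x"]) (use False in auto)
  also have "\<dots> = x ^ (2 ^ n - 1) * ?P"
    by (simp add: prod.distrib card_UNIV card_Diff_singleton)
  finally have "x ^ (2 ^ n - 1) = 1" by (simp add: field_simps)
  then have "x * x ^ (2 ^ n - 1) = x" by simp
  then show ?thesis by (metis power_eq_if power_eq_0_iff zero_neq_numeral)
qed simp

lemma frob_iterate: "(x :: 'a) ^ (2 ^ j) = x \<Longrightarrow> x ^ (2 ^ (j * k)) = x"
  by (induction k) (auto simp: power_add power_mult)

lemma frob_mod: "(x :: 'a) ^ (2 ^ (j mod n)) = x ^ (2 ^ j)"
proof -
  have "x ^ (2 ^ j) = (x ^ (2 ^ (n * (j div n)))) ^ (2 ^ (j mod n))"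
    by (simp flip: power_mult power_add)
  then show ?thesis by (simp add: frob_iterate)
qed

lemma frob_cong: "[j = k] (mod n) \<Longrightarrow> (x :: 'a) ^ (2 ^ j) = x ^ (2 ^ k)"
  unfolding cong_def by (metis frob_mod)

text \<open>With k * i = 1 modulo n, iterating the given equation i times turns it into y =
  y^2.\<close>

lemma frob_fixed:
  assumes "coprime n k" and "(y :: 'a) ^ (2 ^ k) = y"
  shows "y = 0 \<or> y = 1"
proof -
  obtain i where i: "[k * i = 1] (mod n)"
    using cong_solve_coprime_nat[of k n] assms(1) by (auto simp: coprime_commute)
  have "y = y ^ (2 ^ (k * i))" using assms(2) by (simp add: frob_iterate)
  also have "\<dots> = y ^ 2 " using frob_cong[OF i] by simp
  finally show ?thesis by (auto simp: power2_eq_square)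
qed

text \<open>With i = j mod n, the elements of A are fixed by the Frobenius powers i and n - i alike.
  As n is odd, the smaller exponent m is at most (n - 1) / 2, and X^(2^m) - X bounds the
  count.\<close>

lemma card_frob_fixed_le:
  assumes "\<not> n dvd j" and "\<And>x. x \<in> A \<Longrightarrow> (x :: 'a) ^ (2 ^ j) = x"
  shows "card A \<le> 2 ^ ((n - 1) div 2)"
proof -
  define i where "i = j mod n"
  have i: "0 < i" "i < n" using assms(1) n_pos by (auto simp: i_def dvd_eq_mod_eq_0)
  have A1: "x ^ (2 ^ i) = x" if "x \<in> A" for x
    using assms(2)[OF that] by (simp add: i_def frob_mod)
  have A2: "x ^ (2 ^ (n - i)) = x" if "x \<in> A" for x
  proof -
    have "x = (x ^ (2 ^ i)) ^ (2 ^ (n - i))"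
      using i by (simp flip: power_mult power_add)
    then show ?thesis using A1[OF that] by simp
  qed
  define m where "m = min i (n - i)"
  have m: "0 < m" "m \<le> (n - 1) div 2" using i odd_n unfolding m_def by (auto elim!: oddE)
  have "card A \<le> 2 ^ m"
  proof (rule card_poly_zeros_le)
    have "coeff (monom 1 (2 ^ m) - monom 1 1 :: 'a poly) 1 \<noteq> coeff 0 1"
      using m by auto
    then show "(monom 1 (2 ^ m) - monom 1 1 :: 'a poly) \<noteq> 0" by metis
    show "degree (monom 1 (2 ^ m) - monom 1 1 :: 'a poly) \<le> 2 ^ m"
      by (intro degree_diff_le order.trans[OF degree_monom_le]) auto
    show "poly (monom 1 (2 ^ m) - monom 1 1) x = 0" if "x \<in> A" for x :: 'a
      using A1[OF that] A2[OF that] by (simp add: poly_monom m_def min_def)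
  qed
  also have "\<dots> \<le> 2 ^ ((n - 1) div 2)" using m by simp
  finally show ?thesis .
qed

section \<open>The absolute trace\<close>

abbreviation Tr :: "'a \<Rightarrow> 'a" where "Tr \<equiv> abs_trace n"

lemma Tr_add: "Tr (x + y) = Tr x + Tr y"
  by (simp add: abs_trace_def frob_add sum.distrib)

lemma Tr_0 [simp]: "Tr 0 = 0"
  by (simp add: abs_trace_def zero_power)

lemma Tr_1 [simp]: "Tr 1 = 1"
proof -
  have "of_nat n = (1 :: 'a)" using odd_n by (auto elim!: oddE)
  then show ?thesis by (simp add: abs_trace_def)
qed

lemma Tr_square: "Tr (x\<^sup>2) = Tr x"
proof -
  have "Tr (x\<^sup>2) = (\<Sum>i<n. x ^ (2 ^ Suc i))"
    by (simp add: abs_trace_def power_mult)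
  \<comment> \<open>The n + 1 conjugates from x to x^(2^n) = x are summed twice, splitting off the
    first term and then the last.\<close>
  moreover have "(\<Sum>i<Suc n. x ^ (2 ^ i)) = x + (\<Sum>i<n. x ^ (2 ^ Suc i))"
    by (subst sum.lessThan_Suc_shift) simp
  moreover have "(\<Sum>i<Suc n. x ^ (2 ^ i)) = Tr x + x"
    by (simp add: abs_trace_def)
  ultimately show ?thesis by (metis add.commute add_left_cancel)
qed

lemma Tr_frob: "Tr (x ^ (2 ^ k)) = Tr x"
  by (induction k) (simp_all add: power_mult Tr_square mult.commute[of 2])

lemma Tr_cases: "Tr x = 0 \<or> Tr x = 1"
proof -
  have "(Tr x)\<^sup>2 = Tr (x\<^sup>2)"
    unfolding abs_trace_def
    by (subst freshmans_dream_sum) (simp_all add: char_two power2_eq_square power_mult_distrib)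
  then have "Tr x * Tr x = Tr x * 1"
    by (simp add: Tr_square power2_eq_square[of "Tr x"])
  then show ?thesis by (auto simp only: mult_cancel_left)
qed

lemma Tr_frob_diff [simp]: "Tr (x ^ (2 ^ k) + x) = 0"
  by (simp add: Tr_add Tr_frob)

lemma card_Tr_0: "card {x. Tr x = 0} \<le> 2 ^ (n - 1)"
proof (rule card_poly_zeros_le)
  define p :: "'a poly" where "p = (\<Sum>i<n. monom 1 (2 ^ i))"
  have "coeff p 1 = (\<Sum>i<n. if i = 0 then 1 else 0)"
    unfolding p_def by (simp add: coeff_sum) 
  also have "\<dots> = 1" using n_pos by simp
  finally show "p \<noteq> 0" by auto
  show "degree p \<le> 2 ^ (n - 1)"
    unfolding p_def by (intro degree_sum_le order.trans[OF degree_monom_le]) auto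
  show "poly p x = 0" if "x \<in> {x. Tr x = 0}" for x
    using that by (simp add: p_def poly_sum poly_monom abs_trace_def)
qed

lemma Tr_nondegenerate:
  assumes "z \<noteq> 0" shows "\<exists>w. Tr (z * w) = 1"
  using assms Tr_1 by (intro exI[of _ "1 / z"]) simp

text \<open>Additive Hilbert 90, by counting: the fibres of y^(2^k) + y have at most two elements by
  \<open>frob_fixed\<close>, so its range has at least 2^(n-1) elements, while the kernel of the
  trace contains the range and has at most that many.\<close>

lemma Tr_0_iff_frob_diff:
  assumes "coprime n k"
  shows "Tr x = 0 \<longleftrightarrow> (\<exists>y. x = y ^ (2 ^ k) + y)"
proof -
  let ?f = "\<lambda>y :: 'a. y ^ (2 ^ k) + y"
  have "card (UNIV :: 'a set) \<le> 2 * card (range ?f)"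
  proof -
    have "card (?f -` {b}) \<le> 2" for b
    proof (cases "\<exists>y. ?f y = b")
      case True
      then obtain y where y: "?f y = b" by auto
      have "?f -` {b} \<subseteq> {y, y + 1}"
      proof
        fix z assume "z \<in> ?f -` {b}"
        then have "?f z + ?f y = 0" using y by simp
        then have "?f (z + y) = 0" by (simp add: frob_add add_ac)
        then have "z + y = 0 \<or> z + y = 1" using frob_fixed[OF assms, of "z + y"]
          by (simp only: add_eq_zero_iff)
        then show "z \<in> {y, y + 1}" by (metis add.commute add_self_left add_eq_zero_iff insertCI)
      qed
      then have "card (?f -` {b}) \<le> card {y, y + 1}" by (intro card_mono) auto
      also have "\<dots> \<le> 2" by (simp add: card_insert_if)
      finally show ?thesis .
    qed (auto simp: vimage_def)
    then have "(\<Sum>b\<in>range ?f. card (?f -` {b})) \<le> (\<Sum>b\<in>range ?f. 2)"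
      by (intro sum_mono) auto
    moreover have "card (UNIV :: 'a set) = (\<Sum>b\<in>range ?f. card (?f -` {b}))"
      by (subst card_UN_disjoint[symmetric]) (auto intro!: arg_cong[of _ _ card])
    ultimately show ?thesis by simp
  qed
  then have "2 * 2 ^ (n - 1) \<le> 2 * card (range ?f)"
    using n_pos by (simp add: card_UNIV flip: power_Suc)
  then have "card {x. Tr x = 0} \<le> card (range ?f)" using card_Tr_0 by simp
  moreover have "range ?f \<subseteq> {x. Tr x = 0}" by auto
  ultimately have "range ?f = {x. Tr x = 0}" by (intro card_seteq) auto
  then show ?thesis by auto
qed

subsection \<open>The presemifield\<close>

abbreviation td (infixl "\<star>" 70) where "x \<star> y \<equiv> td_mult n (x :: 'a) y"

abbreviation rt :: "'a \<Rightarrow> 'a" where "rt y \<equiv> y ^ (2 ^ (n - 1))"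

lemma rt_square: "(rt y)\<^sup>2 = y"
proof -
  have "(rt y)\<^sup>2 = y ^ (2 ^ Suc (n - 1))" by (simp add: power_mult mult.commute flip: power_mult)
  then show ?thesis using n_pos by simp
qed

lemma td_add_left: "(x + y) \<star> a = x \<star> a + y \<star> a"
  by (simp add: td_mult_def Tr_add square_add algebra_simps)

lemma td_add_right: "x \<star> (a + b) = x \<star> a + x \<star> b"
  by (simp add: td_mult_def Tr_add frob_add algebra_simps)

lemma td_0_left [simp]: "0 \<star> a = 0"
  by (simp add: td_mult_def)

lemma td_0_right [simp]: "x \<star> 0 = 0"
  by (simp add: td_mult_def zero_power)

lemma td_1_right [simp]: "x \<star> 1 = x"
  by (simp add: td_mult_def Tr_square add.assoc)

lemma td_Tr_0: "Tr x = 0 \<Longrightarrow> x \<star> a = x * a + Tr (x\<^sup>2 * a)"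
  by (simp add: td_mult_def)

lemma Tr_times_Tr [simp]: "Tr (x * Tr y) = Tr x * Tr y"
  using Tr_cases[of y] by auto

text \<open>To solve \<open>x \<star> a = w\<close>, write x a = w + t with the bit t = Tr(x^2 a).
  Multiplying by x and taking traces gives t = Tr(x w), because Tr(x t) = t Tr(x) = 0.\<close>

lemma td_right_inverse:
  assumes "Tr x = 0" and "x \<noteq> 0"
  shows "x \<star> ((w + Tr (x * w)) / x) = w"
proof -
  have "x\<^sup>2 * ((w + Tr (x * w)) / x) = x * w + x * Tr (x * w)"
    using assms(2) by (simp add: power2_eq_square field_simps)
  then show ?thesis using assms by (simp add: td_Tr_0 Tr_add add.assoc)
qed

lemma td_left_cancel:
  assumes "Tr x = 0" and "x \<noteq> 0" and eq: "x \<star> s = x \<star> t"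
  shows "s = t"
proof -
  have "x \<star> (s + t) = 0" using eq by (simp add: td_add_right)
  then have 1: "x * (s + t) = Tr (x\<^sup>2 * (s + t))"
    using assms(1) by (simp add: td_Tr_0 add_eq_zero_iff)
  have "Tr (x\<^sup>2 * (s + t)) = Tr (x * Tr (x\<^sup>2 * (s + t)))"
    using arg_cong[OF 1, of "\<lambda>c. Tr (x * c)"] by (simp add: power2_eq_square mult.assoc)
  then have "x * (s + t) = 0" using 1 assms(1) by simp
  then show ?thesis using assms(2) by (simp add: add_eq_zero_iff)
qed

text \<open>This is the no-three-collinear property on lines through the origin: p and r parametrise
  affine points of the hyperoval on the line of slope a.\<close>

lemma secant_unique:
  assumes cop: "coprime n k"
    and p: "p = (p ^ (2 ^ k) + p) \<star> a" "p \<noteq> 0"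
    and r: "r = (r ^ (2 ^ k) + r) \<star> a" "r \<noteq> 0"
  shows "p = r"
proof -
  define X where "X y = y ^ (2 ^ k) + y" for y :: 'a
  \<comment> \<open>The bit c y is the trace term of the product. Adding it to y turns the equation
    into y = X y * a in the field, and X is unchanged because it vanishes on bits.\<close>
  define c where "c y = Tr ((X y)\<^sup>2 * a)" for y
  have X_add: "X (y + z) = X y + X z" for y z by (simp add: X_def frob_add add_ac)
  have X_bit: "X (c y) = 0" for y
    using Tr_cases[of "(X y)\<^sup>2 * a"] by (auto simp: X_def c_def)
  have norm: "y + c y = X (y + c y) * a" if "y = X y \<star> a" for y
  proof -
    have "y = X y * a + c y" using that td_Tr_0[of "X y" a] by (simp add: X_def c_def)
    then show ?thesis by (metis X_add X_bit add.right_neutral add.assoc add_self)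
  qed
  have nz: "y + c y \<noteq> 0" if "y \<noteq> 0" for y
  proof
    assume *: "y + c y = 0"
    then have "X y = 0" using X_bit[of y] by (simp add: add_eq_zero_iff)
    then have "c y = 0" by (simp add: c_def)
    then show False using * that by simp
  qed
  define u v where "u = p + c p" and "v = r + c r"
  have u: "u = X u * a" "u \<noteq> 0" and v: "v = X v * a" "v \<noteq> 0"
    using norm[of p] norm[of r] nz p r by (auto simp: u_def v_def X_def)
  \<comment> \<open>The normalised equation fixes the quotient y^(2^k) / y in terms of a alone, so u
    / v is invariant under the Frobenius power k.\<close>
  have ratio: "(y ^ (2 ^ k)) * a = y * (1 + a)" if "y = X y * a" for y
  proof -
    have "y ^ (2 ^ k) * a = X y * a + y * a" by (simp add: X_def algebra_simps)
    then show ?thesis using that by (simp add: algebra_simps)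
  qed
  have "a \<noteq> 0" using u by auto
  have a1: "1 + a \<noteq> 0" using ratio[OF u(1)] u(2) \<open>a \<noteq> 0\<close> by auto
  have "(u / v) ^ (2 ^ k) = (u ^ (2 ^ k) * a) / (v ^ (2 ^ k) * a)"
    using \<open>a \<noteq> 0\<close> by (simp add: power_divide)
  also have "\<dots> = u / v" using a1 by (simp add: ratio u(1) v(1) flip: u(1) v(1))
  finally have "u / v = 1" using frob_fixed[OF cop, of "u / v"] u v by auto
  then have "u = v" using v by simp
  \<comment> \<open>The corrections depend only on X, so u = v makes them equal and they can be
    removed again.\<close>
  moreover have "X u = X p" "X v = X r" using X_add X_bit by (simp_all add: u_def v_def)
  ultimately have "c p = c r" by (simp add: c_def)
  with \<open>u = v\<close> show ?thesis by (simp add: u_def v_def)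
qed

section \<open>Two unsolvable identities for the multiplication\<close>

text \<open>The left side has trace Tr 1 = 1 as n is odd; equivalently, there is no primitive cube
  root of unity.\<close>

lemma quadratic_nonzero: "s\<^sup>2 + s + 1 \<noteq> (0 :: 'a)"
proof
  assume "s\<^sup>2 + s + 1 = 0"
  then have "Tr (s\<^sup>2 + s + 1) = Tr 0" by simp
  then show False by (simp add: Tr_add Tr_square)
qed

lemma Tr_separates:
  assumes "x \<noteq> y" shows "\<exists>w. Tr (x * w) \<noteq> Tr (y * w)"
proof -
  obtain w where "Tr ((x + y) * w) = 1"
    using Tr_nondegenerate[of "x + y"] assms by (auto simp: add_eq_zero_iff)
  then show ?thesis by (intro exI[of _ w]) (auto simp: Tr_add distrib_right)
qed

text \<open>Each trace condition at worst halves the set. For n at least 5 at least 8 elements w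
  remain on which both bits vanish, too many zeros for a nonzero quadratic.\<close>

lemma card_two_traces:
  "2 ^ n \<le> 4 * card {w :: 'a. Tr (x * w) = 0 \<and> Tr (y * w) = 0}"
proof -
  have 1: "card (UNIV :: 'a set) \<le> 2 * card {w \<in> UNIV. Tr (x * w) = 0}"
    by (rule card_additive_le[where c = 1]) (use Tr_cases in \<open>auto simp: distrib_left Tr_add\<close>)
  have 2: "card {w. Tr (x * w) = 0} \<le> 2 * card {w \<in> {w. Tr (x * w) = 0}. Tr (y * w) = 0}"
    by (rule card_additive_le[where c = 1]) (use Tr_cases in \<open>auto simp: distrib_left Tr_add\<close>)
  show ?thesis using 1 2 by (simp add: card_UNIV)
qed

lemma card_quadratic_le:
  assumes "a \<noteq> 0 \<or> b \<noteq> 0 \<or> c \<noteq> (0 :: 'a)" and "\<And>w. w \<in> W \<Longrightarrow> a * w\<^sup>2 + b * w + c = 0"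
  shows "card W \<le> 2"
  by (rule card_poly_zeros_le[of "[:c, b, a:]"])
     (use assms in \<open>auto simp: algebra_simps power2_eq_square\<close>)

text \<open>
  Let a central collineation with axis x = 0 and centre (0, 0) map the vertical line at x to the one
  at y, and the line at infinity to the one at u. Then the left multiplications satisfy
  L(u)^(-1) = L(x)^(-1) + L(y)^(-1), the equation refuted here.
\<close>

lemma no_vertical_elation_identity:
  assumes n5: "n \<ge> 5" and x: "Tr x = 0" "x \<noteq> 0" and y: "Tr y = 0" "y \<noteq> 0" and "x \<noteq> y"
    and id: "\<And>w. u \<star> ((w + Tr (x * w)) / x + (w + Tr (y * w)) / y) = w"
  shows False
proof -
  define W where "W = {w. Tr (x * w) = 0 \<and> Tr (y * w) = 0}"
  define r where "r = 1 / x + 1 / y"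
  have r: "r \<noteq> 0" "x * y * r = x + y" using x y \<open>x \<noteq> y\<close>
    by (auto simp: r_def field_simps add_eq_zero_iff)
  have "32 \<le> (2 :: nat) ^ n" using power_increasing[OF n5, of "2 :: nat"] by simp
  then have cW: "card W \<ge> 8" using card_two_traces[of x y] by (simp add: W_def)
  \<comment> \<open>On W the identity reads \<open>u \<star> (r * w) = w\<close>. Squaring clears
    the square root and leaves a quadratic in w whose constant term is a bit.\<close>
  have W: "(u\<^sup>2 * r\<^sup>2 + 1) * w\<^sup>2 + Tr u * r * w + Tr (u\<^sup>2 * (r * w)) = 0" if "w \<in> W" for w
  proof -
    have "u \<star> (r * w) = w" using id[of w] that by (simp add: W_def r_def distrib_right)
    then have "(u \<star> (r * w))\<^sup>2 + w\<^sup>2 = 0" by simp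
    moreover have "(u \<star> (r * w))\<^sup>2 = (u * r * w)\<^sup>2 + Tr u * (r * w) + Tr (u\<^sup>2 * (r * w))"
      unfolding td_mult_def square_add power_mult_distrib rt_square
      using Tr_cases[of u] Tr_cases[of "u\<^sup>2 * (r * w)"] by (auto simp: power_mult_distrib)
    ultimately show ?thesis by (simp add: algebra_simps power_mult_distrib)
  qed
  \<comment> \<open>Split W by that bit. At most two elements have bit 1, so more than two have bit
    0, and the quadratic with constant term 0 must vanish identically.\<close>
  define D where "D c = {w \<in> W. Tr (u\<^sup>2 * (r * w)) = c}" for c
  have "card (D 1) \<le> 2"
    by (rule card_quadratic_le[of "u\<^sup>2 * r\<^sup>2 + 1" "Tr u * r" 1]) (auto simp: D_def dest: W)
  moreover have "W = D 0 \<union> D 1" using Tr_cases by (auto simp: D_def)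
  ultimately have "card (D 0) > 2"
    using cW card_Un_le[of "D 0" "D 1"] by simp
  then have "u\<^sup>2 * r\<^sup>2 + 1 = 0 \<and> Tr u * r = 0"
    using card_quadratic_le[of "u\<^sup>2 * r\<^sup>2 + 1" "Tr u * r" 0 "D 0"] W by (fastforce simp: D_def)
  then have "(u * r)\<^sup>2 = 1\<^sup>2" and Tu: "Tr u = 0"
    using r by (auto simp: power_mult_distrib add_eq_zero_iff)
  then have ur: "u * r = 1" by (simp only: square_inject)
  \<comment> \<open>For a w separating the two traces, exactly one of u / x and u / y survives in
    the identity and would have to be a bit.\<close>
  obtain w where "Tr (x * w) \<noteq> Tr (y * w)" using Tr_separates[OF \<open>x \<noteq> y\<close>] by auto
  define T where "T = (w + Tr (x * w)) / x + (w + Tr (y * w)) / y"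
  have T: "u * T = w + u * (Tr (x * w) / x + Tr (y * w) / y)"
  proof -
    have "u * T = u * r * w + u * (Tr (x * w) / x + Tr (y * w) / y)"
      by (simp add: T_def r_def add_divide_distrib algebra_simps)
    then show ?thesis by (simp add: ur)
  qed
  have "u * T + Tr (u\<^sup>2 * T) = w" using id[of w] Tu by (simp add: T_def td_Tr_0)
  then have "w + (u * (Tr (x * w) / x + Tr (y * w) / y) + Tr (u\<^sup>2 * T)) = w + 0"
    unfolding T by (simp add: add_ac)
  then have bit: "u * (Tr (x * w) / x + Tr (y * w) / y) = Tr (u\<^sup>2 * T)"
    by (simp only: add_left_cancel add_eq_zero_iff)
  have "u \<noteq> x" "u \<noteq> y" "u \<noteq> 0"
    using ur x y by (auto simp: r_def distrib_left)
  then have no: "u / x \<noteq> 0" "u / x \<noteq> 1" "u / y \<noteq> 0" "u / y \<noteq> 1" using x y by auto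
  show False
    using Tr_cases[of "x * w"] Tr_cases[of "y * w"] Tr_cases[of "u\<^sup>2 * T"] bit no
      \<open>Tr (x * w) \<noteq> Tr (y * w)\<close> by auto
qed

text \<open>
  The map (x, y) \<mapsto> (x + y, y) would be a shear with axis y = 0 taking (\<infinity>) to (1);
  it sends the line of slope a through (0, 0) to one of slope b.
\<close>

lemma no_shear_identity:
  assumes "n \<ge> 5" and "a \<noteq> 0" "a \<noteq> 1" and id: "\<And>x. (x + x \<star> a) \<star> b = x \<star> a"
  shows False
proof -
  define W where "W = {w. Tr (1 * w) = 0 \<and> Tr (rt a * w) = 0}"
  have "32 \<le> (2 :: nat) ^ n" using power_increasing[OF assms(1), of "2 :: nat"] by simp
  then have cW: "card W \<ge> 8" using card_two_traces[of 1 "rt a"] by (simp add: W_def)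
  have Tr_rt: "Tr (x\<^sup>2 * a) = Tr (rt a * x)" for x
    using Tr_square[of "rt a * x"] unfolding power_mult_distrib rt_square by (simp add: mult.commute)
  have ab: "(1 + a) * b = a"
  \<comment> \<open>On W, where \<open>x \<star> a\<close> is just x a, the identity would determine
    x from the two bits i and j. That allows 4 values of x, but W has at least 8 elements.\<close>
  proof (rule ccontr)
    assume "(1 + a) * b \<noteq> a"
    then have C: "(1 + a) * b + a \<noteq> 0" by (simp add: add_eq_zero_iff)
    let ?g = "\<lambda>(i, j). (i * rt b + j) / ((1 + a) * b + a)"
    have "x \<in> ?g ` ({0, 1} \<times> {0, 1})" if "x \<in> W" for x
    proof -
      have x: "Tr x = 0" "Tr (x\<^sup>2 * a) = 0" using that by (simp_all add: W_def Tr_rt)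
      define i where "i = Tr (x + x * a)"
      define j where "j = Tr ((x + x * a)\<^sup>2 * b)"
      have "(x + x * a) \<star> b = x * a" using id[of x] x by (simp add: td_Tr_0)
      then have E: "(x + x * a) * b + (i * rt b + j) = x * a"
        by (simp only: td_mult_def i_def j_def add.assoc)
      have "x * ((1 + a) * b + a) = (x + x * a) * b + x * a"
        by (simp add: algebra_simps)
      also have "\<dots> = (x + x * a) * b + ((x + x * a) * b + (i * rt b + j))"
        by (simp only: E)
      also have "\<dots> = i * rt b + j" by (simp only: add_self_left)
      finally have "x * ((1 + a) * b + a) = i * rt b + j" .
      then have "x = ?g (i, j)" using C by (simp add: field_simps)
      moreover have "(i, j) \<in> {0, 1} \<times> {0, 1}"
        using Tr_cases[of "x + x * a"] Tr_cases[of "(x + x * a)\<^sup>2 * b"] by (auto simp: i_def j_def)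
      ultimately show ?thesis by (rule image_eqI)
    qed
    then have "card W \<le> card (?g ` ({0, 1} \<times> {0, 1}))"
      by (intro card_mono subsetI) auto
    also have "\<dots> \<le> card ({0, 1 :: 'a} \<times> {0, 1 :: 'a})" by (rule card_image_le) simp
    finally show False using cW by simp
  qed
  define s where "s = rt a"
  have s: "s\<^sup>2 = a" unfolding s_def by (rule rt_square)
  have s01: "s \<noteq> 0" "s \<noteq> 1" using s assms by auto
  \<comment> \<open>Square root of the relation \<open>ab\<close>: rt b = s / (1 + s), written
    without division.\<close>
  have rtb: "rt b * (1 + s) = s"
  proof -
    have "(rt b * (1 + s))\<^sup>2 = s\<^sup>2"
      unfolding power_mult_distrib rt_square square_add s using ab by (simp add: mult.commute)
    then show ?thesis by (simp only: square_inject)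
  qed
  have "1 + a = (1 + s) * (1 + s)" using square_add[of 1 s] by (simp add: s power2_eq_square[of "1 + s"])
  then have rtb': "rt b * (1 + a) = s * (1 + s)" by (metis mult.assoc rtb)
  obtain x where "Tr (1 * x) \<noteq> Tr (s * x)" using Tr_separates[of 1 s] s01 by auto
  then have neq: "Tr x \<noteq> Tr (x\<^sup>2 * a)" by (simp add: Tr_rt s_def)
  define e where "e = Tr x * s + Tr (x\<^sup>2 * a)"
  define y where "y = x + x \<star> a"
  have xa: "x \<star> a = x * a + e" by (simp add: td_mult_def e_def s_def add.assoc)
  have "y * b + Tr y * rt b + Tr (y\<^sup>2 * b) = x * a + e"
    using id[of x] xa by (simp add: td_mult_def y_def)
  \<comment> \<open>Multiplying by 1 + a clears the denominators of b and rt b; the terms in x then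
    cancel, leaving a polynomial in s with bit coefficients.\<close>
  then have "(y * b + Tr y * rt b + Tr (y\<^sup>2 * b) + (x * a + e)) * (1 + a) = 0" by simp
  then have "y * ((1 + a) * b) + Tr y * (rt b * (1 + a)) + Tr (y\<^sup>2 * b) * (1 + a)
      + (x * a + e) * (1 + a) = 0"
    by (simp add: algebra_simps)
  then have "y * a + Tr y * (s * (1 + s)) + Tr (y\<^sup>2 * b) * (1 + a) + (x * a + e) * (1 + a) = 0"
    by (simp only: ab rtb')
  moreover have "y * a = x * a + x * a * a + e * a"
    by (simp add: y_def xa algebra_simps)
  ultimately have "e + Tr y * (s * (1 + s)) + Tr (y\<^sup>2 * b) * (1 + a) = 0"
    by (simp add: algebra_simps)
  \<comment> \<open>Since e is s or 1, the left side is always one of 1, s, s^2 and s^2 + s + 1,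
    none of which is 0.\<close>
  moreover have "s \<noteq> 1 + s\<^sup>2" "s\<^sup>2 \<noteq> 1 + s"
    using quadratic_nonzero[of s] add_eq_zero_iff[of s "1 + s\<^sup>2"]
      add_eq_zero_iff[of "s\<^sup>2" "1 + s"] by (simp_all add: add_ac)
  ultimately show False
    using Tr_cases[of x] Tr_cases[of "x\<^sup>2 * a"] Tr_cases[of y] Tr_cases[of "y\<^sup>2 * b"] neq
      quadratic_nonzero[of s] s01 assms(2,3)
    by (auto simp: e_def algebra_simps add_eq_zero_iff simp flip: s power2_eq_square)
qed

section \<open>Autotopisms and Frobenius exponents\<close>

lemma add_exchange:
  assumes "p + q = r + (s :: 'a)"
  shows "p + r = q + s"
proof -
  have "p + r = (p + q) + (q + r)" by (simp add: add_ac)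
  also have "\<dots> = q + s" unfolding assms by (simp add: add_ac)
  finally show ?thesis .
qed

lemma autotopism_exponents:
  fixes A N :: "'a \<Rightarrow> 'a"
  assumes n5: "n \<ge> 5" and cop: "coprime n d" "coprime n e"
    and add: "\<And>x y. A (x + y) = A x + A y" and "inj A"
    and mult: "\<And>x a. A (x \<star> a) = A x \<star> N a"
    and frob: "\<And>y. A (y ^ (2 ^ d)) = A y ^ (2 ^ e)"
  shows "[d = e] (mod n)"
proof -
  have A0 [simp]: "A 0 = 0" using add[of 0 0] by simp
  have A_eq: "A x = A y \<longleftrightarrow> x = y" for x y using \<open>inj A\<close> by (auto dest: injD)
  have Anz: "A x = 0 \<longleftrightarrow> x = 0" for x using A_eq[of x 0] by simp
  have A1 [simp]: "A 1 = 1" using frob_fixed[OF cop(2), of "A 1"] frob[of 1] Anz[of 1] by auto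
  \<comment> \<open>A trace-zero element is y^(2^d) + y, and A maps it to (A y)^(2^e) + A y, again
    of trace zero.\<close>
  have TrA: "Tr (A x) = 0" if "Tr x = 0" for x
    using that Tr_0_iff_frob_diff[OF cop(1), of x] by (auto simp: add frob)
  define bit where "bit = {0, 1 :: 'a}"
  have bit_add: "b + c \<in> bit" if "b \<in> bit" "c \<in> bit" for b c using that by (auto simp: bit_def)
  have bit_Tr: "Tr z \<in> bit" and bit_ATr: "A (Tr z) \<in> bit" for z
    using Tr_cases[of z] by (auto simp: bit_def)
  define H where "H = {x. Tr x = 0}"
  have H_add: "x + y \<in> H" if "x \<in> H" "y \<in> H" for x y using that by (simp add: H_def Tr_add)
  \<comment> \<open>For x in H both products are field products plus a bit, and A fixes 0 and
    1.\<close>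
  have mod_bit: "A (x * a) + A x * N a \<in> bit" if "x \<in> H" for x a
  proof -
    have "A (x * a) + A (Tr (x\<^sup>2 * a)) = A x * N a + Tr ((A x)\<^sup>2 * N a)"
      using mult[of x a] that TrA[of x] by (simp add: H_def td_Tr_0 add)
    then have "A (x * a) + A x * N a = A (Tr (x\<^sup>2 * a)) + Tr ((A x)\<^sup>2 * N a)"
      by (rule add_exchange)
    then show ?thesis by (simp add: bit_add bit_Tr bit_ATr)
  qed
  have sym: "A x * N y + A y * N x \<in> bit" if "x \<in> H" "y \<in> H" for x y
  proof -
    have "A x * N y + A y * N x = (A (x * y) + A x * N y) + (A (y * x) + A y * N x)"
      by (simp add: mult.commute add_ac)
    then show ?thesis using that by (simp only: bit_add mod_bit)
  qed
  have "32 \<le> (2 :: nat) ^ n" using power_increasing[OF n5, of "2 :: nat"] by simp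
  moreover have "card (UNIV :: 'a set) \<le> 2 * card {x \<in> UNIV. Tr x = 0}"
    by (rule card_additive_le[where c = 1]) (use Tr_cases in \<open>auto simp: Tr_add\<close>)
  ultimately have cH: "2 ^ n \<le> 2 * card H" "card H \<ge> 16" by (simp_all add: card_UNIV H_def)
  define \<rho> where "\<rho> x = N x / A x" for x
  \<comment> \<open>By \<open>sym\<close>, A x * A y * (\<rho> x + \<rho> y) is a bit on H, hence 1
    where \<rho> differs. A third element z outside {0, x, y, x + y} then gives a contradiction: if
    \<rho> z equals \<rho> x or \<rho> y, then z is x or y; otherwise the three differences sum to
    0, forcing z = x + y.\<close>
  have const: "\<rho> x = \<rho> y" if x: "x \<in> H" "x \<noteq> 0" and y: "y \<in> H" "y \<noteq> 0" for x y
  proof (rule ccontr)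
    assume ne: "\<rho> x \<noteq> \<rho> y"
    have one: "\<rho> u + \<rho> v = 1 / (A u * A v)"
      if "u \<in> H" "u \<noteq> 0" "v \<in> H" "v \<noteq> 0" "\<rho> u \<noteq> \<rho> v" for u v
    proof -
      have "A u * N v + A v * N u = A u * A v * (\<rho> u + \<rho> v)"
        using that by (simp add: Anz \<rho>_def field_simps)
      moreover have "A u * A v * (\<rho> u + \<rho> v) \<noteq> 0" using that by (simp add: Anz add_eq_zero_iff)
      ultimately have "A u * A v * (\<rho> u + \<rho> v) = 1"
        using sym[of u v] that by (simp add: bit_def)
      then show ?thesis using that by (simp add: Anz field_simps)
    qed
    have "card {0, x, y, x + y} \<le> 4" by (simp add: card_insert_if)
    then have "\<not> H \<subseteq> {0, x, y, x + y}" using cH card_mono[of "{0, x, y, x + y}" H] by auto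
    then obtain z where z: "z \<in> H" "z \<noteq> 0" "z \<noteq> x" "z \<noteq> y" "z \<noteq> x + y" by auto
    note xy = one[OF x y ne]
    consider "\<rho> z = \<rho> x" | "\<rho> z = \<rho> y" | "\<rho> z \<noteq> \<rho> x" "\<rho> z \<noteq> \<rho> y" by auto
    then show False
    proof cases
      case 1
      then have "1 / (A z * A y) = 1 / (A x * A y)" using one[OF z(1,2) y] xy ne by metis
      then show False using x y z by (auto simp: Anz A_eq)
    next
      case 2
      then have "1 / (A x * A z) = 1 / (A x * A y)" using one[OF x z(1,2)] xy ne by metis
      then show False using x y z by (auto simp: Anz A_eq)
    next
      case 3
      have "1 / (A x * A y) + 1 / (A x * A z) + 1 / (A y * A z) = 0"
        unfolding xy[symmetric] one[OF x z(1,2) 3(1)[symmetric], symmetric]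
          one[OF y z(1,2) 3(2)[symmetric], symmetric]
        by (simp add: add_ac)
      then have "A x + A y + A z = 0" using x y z by (simp add: Anz field_simps)
      then have "A (x + y) = A z" by (simp add: add add_eq_zero_iff)
      then show False using z by (simp add: A_eq)
    qed
  qed
  obtain c where c: "\<And>x. x \<in> H \<Longrightarrow> x \<noteq> 0 \<Longrightarrow> N x = c * A x"
  proof -
    have "\<exists>x\<in>H. x \<noteq> 0" using cH card_mono[of "{0}" H] by auto
    then obtain x where "x \<in> H" "x \<noteq> 0" by auto
    then have "N y = \<rho> x * A y" if "y \<in> H" "y \<noteq> 0" for y
      using const[of x y] that Anz[of y] by (simp add: \<rho>_def)
    then show ?thesis by (rule that)
  qed
  \<comment> \<open>Iterating \<open>frob\<close> k times, with k inverse to d modulo n, turns it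
    into a statement about squaring.\<close>
  obtain k where k: "[d * k = 1] (mod n)"
    using cong_solve_coprime_nat[of d n] cop(1) by (auto simp: coprime_commute)
  define m where "m = e * k"
  have Asq: "A (x\<^sup>2) = A x ^ (2 ^ m)" for x
  proof -
    have "A (x ^ (2 ^ (d * j))) = A x ^ (2 ^ (e * j))" for j
      by (induction j arbitrary: x) (simp_all add: power_add power_mult frob)
    from this[of k] show ?thesis using frob_cong[OF k, of x] by (simp add: m_def)
  qed
  \<comment> \<open>Taking a = x in \<open>mod_bit\<close> shows that \<phi> takes bit values on H,
    so its kernel K has index at most 4 in the field.\<close>
  define \<phi> where "\<phi> x = A x ^ (2 ^ m) + c * (A x)\<^sup>2" for x
  define K where "K = {x \<in> H. \<phi> x = 0}"
  have "card H \<le> 2 * card K"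
    unfolding K_def
  proof (rule card_additive_le[where c = 1])
    fix x y assume "x \<in> H" "y \<in> H"
    then show "x - y \<in> H" "\<phi> (x - y) = \<phi> x - \<phi> y"
      by (simp_all add: H_add \<phi>_def add frob_add square_add algebra_simps)
    show "\<phi> x = 0 \<or> \<phi> x = 1"
    proof (cases "x = 0")
      case False
      then show ?thesis
        using mod_bit[OF \<open>x \<in> H\<close>, of x] c[OF \<open>x \<in> H\<close>] Asq[of x]
        by (simp add: bit_def \<phi>_def power2_eq_square mult_ac)
    qed (simp add: \<phi>_def zero_power)
  qed simp
  then have cK: "2 ^ n \<le> 4 * card K" "card K \<ge> 8" using cH by auto
  have K: "A x ^ (2 ^ m) = c * (A x)\<^sup>2" if "x \<in> K" for x
    using that by (simp add: K_def \<phi>_def add_eq_zero_iff)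
  have "\<not> K \<subseteq> {0}" using cK card_mono[of "{0}" K] by auto
  then obtain x where x: "x \<in> K" "x \<noteq> 0" by auto
  have "c \<noteq> 0" using K[OF x(1)] x(2) by (auto simp: Anz)
  \<comment> \<open>The constant c cancels in quotients, leaving t^(2^m) = t^2. Adding n - 1 to the
    exponent stands for subtracting 1 modulo n.\<close>
  have fixed: "t ^ (2 ^ (m + (n - 1))) = t" if t: "t \<in> (\<lambda>y. A y / A x) ` K" for t
  proof -
    have "t ^ (2 ^ m) = t\<^sup>2" using t \<open>c \<noteq> 0\<close> x by (auto simp: power_divide K)
    then have "t ^ (2 ^ (m + (n - 1))) = t ^ (2 ^ Suc (n - 1))"
      by (simp add: power_add power_mult)
    then show ?thesis using n_pos by simp
  qed
  have "card ((\<lambda>y. A y / A x) ` K) = card K"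
    by (rule card_image) (use x in \<open>auto intro!: inj_onI simp: Anz A_eq\<close>)
  \<comment> \<open>Here n > 3 matters: (n - 1) / 2 + 2 < n.\<close>
  moreover have "2 ^ ((n - 1) div 2) < card K"
  proof -
    have "4 * 2 ^ ((n - 1) div 2) = (2 :: nat) ^ ((n - 1) div 2 + 2)" by (simp add: power_add)
    also have "\<dots> < 2 ^ n" using n5 by (intro power_strict_increasing) auto
    finally show ?thesis using cK by simp
  qed
  ultimately have "n dvd m + (n - 1)"
    using card_frob_fixed_le[of "m + (n - 1)", OF _ fixed] by fastforce
  then have "[m + (n - 1) = n] (mod n)" by (simp add: cong_def)
  then have "[m + (n - 1) = 1 + (n - 1)] (mod n)" using n_pos by simp
  then have "[e * k = d * k] (mod n)"
    using k unfolding m_def by (metis cong_add_rcancel_nat cong_sym cong_trans)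
  moreover have "coprime k n" using k
    by (metis cong_imp_coprime cong_sym coprime_1_left coprime_mult_left_iff)
  ultimately show ?thesis using cong_mult_rcancel_nat cong_sym by blast
qed

subsection \<open>Collineations of the plane\<close>

abbreviation L where "L \<equiv> td_plane_lines n :: 'a point set set"

primrec shear_translation :: "'a \<Rightarrow> 'a \<Rightarrow> 'a \<Rightarrow> 'a point \<Rightarrow> 'a point" where
  "shear_translation u v s (Aff x y) = Aff (x + u) (y + x \<star> s + v)"
| "shear_translation u v s (Ideal c) = Ideal (c + s)"
| "shear_translation u v s Ideal_infty = Ideal_infty"

text \<open>The second map shears at x + u instead of x; the extra \<open>u \<star> s\<close> in its
  translation part compensates for this.\<close>

lemma shear_translation_inverse:
  "shear_translation u (v + u \<star> s) s (shear_translation u v s p) = p"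
  "shear_translation u v s (shear_translation u (v + u \<star> s) s p) = p"
  by (cases p; simp add: td_add_left add_ac)+

lemma shear_translation_image: "shear_translation u v s ` l = shear_translation u (v + u \<star> s) s -` l"
proof (intro set_eqI iffI)
  fix p assume "p \<in> shear_translation u (v + u \<star> s) s -` l"
  then have "shear_translation u v s (shear_translation u (v + u \<star> s) s p) \<in> shear_translation u v s ` l"
    by (intro imageI) simp
  then show "p \<in> shear_translation u v s ` l" by (simp only: shear_translation_inverse)
qed (auto simp only: shear_translation_inverse vimage_eq)

lemma line_through_slope:
  assumes "l \<in> L" "Ideal a \<in> l" "Aff x y \<in> l"
  shows "l = td_line n a (y + x \<star> a)"
  using assms by (elim plane_line_cases) (simp_all add: add.assoc add.commute[of "_ \<star> _"])

lemma shear_translation_vert_line [simp]: "shear_translation u v s ` vert_line a = vert_line (a + u)"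
proof -
  have "p \<in> shear_translation u v s ` vert_line a \<longleftrightarrow> p \<in> vert_line (a + u)" for p
    by (cases p) (auto simp: shear_translation_image add_ac)
  then show ?thesis by blast
qed

lemma shear_translation_line_infty [simp]: "shear_translation u v s ` line_infty = line_infty"
proof -
  have "p \<in> shear_translation u v s ` line_infty \<longleftrightarrow> p \<in> line_infty" for p
    by (cases p) (auto simp: shear_translation_image)
  then show ?thesis by blast
qed

lemma shift_eq: "x + y = z \<longleftrightarrow> x = z + (y :: 'a)"
  by (metis add.assoc add.right_neutral add_self)

lemma shear_translation_td_line [simp]:
  "shear_translation u v s ` td_line n c b = td_line n (c + s) (b + v + u \<star> (c + s))"
proof -
  have "p \<in> shear_translation u v s ` td_line n c b \<longleftrightarrow> p \<in> td_line n (c + s) (b + v + u \<star> (c + s))" for p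
  proof (cases p)
    case (Aff x y)
    have "p \<in> shear_translation u v s ` td_line n c b \<longleftrightarrow> y + (x \<star> s + (v + u \<star> s)) = (x + u) \<star> c + b"
      by (simp add: Aff shear_translation_image add.assoc)
    also have "\<dots> \<longleftrightarrow> y = (x + u) \<star> c + b + (x \<star> s + (v + u \<star> s))"
      by (rule shift_eq)
    also have "(x + u) \<star> c + b + (x \<star> s + (v + u \<star> s)) = x \<star> (c + s) + (b + v + u \<star> (c + s))"
      by (simp add: td_add_left td_add_right add_ac)
    finally show ?thesis by (simp add: Aff)
  qed (auto simp: shear_translation_image shift_eq)
  then show ?thesis by blast
qed

lemma shear_translation_collineation [simp]: "collineation L (shear_translation u v s)"
proof -
  have "shear_translation u v s ` l \<in> L" if "l \<in> L" for u v s l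
    using that by (elim plane_line_cases) simp_all
  then show ?thesis
    by (intro collineationI[of "shear_translation u (v + u \<star> s) s"] shear_translation_inverse)
qed

section \<open>Every collineation fixes the line at infinity and the point (\<infinity>)\<close>

lemma translation_line_infty: "translation_line L line_infty"
  unfolding translation_line_def
proof (intro ballI impI)
  fix P k A B
  assume *: "P \<in> line_infty" "k \<in> L" "A \<in> k" "B \<in> k" "P \<in> k" "A \<notin> line_infty" "B \<notin> line_infty"
  obtain x y x' y' where AB: "A = Aff x y" "B = Aff x' y'"
    using *(6,7) by (cases A; cases B) auto
  \<comment> \<open>The translation by B - A; in characteristic 2 differences are sums.\<close>
  define g where "g = shear_translation (x + x') (y + y') 0"
  have "g ` l = l" if "l \<in> L" "P \<in> l" for l
    using that *(2)
  proof (elim plane_line_cases)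
    fix a b a' b' assume l: "l = td_line n a b" and k: "k = td_line n a' b'"
    then have "a = a'" using that * by (cases P) simp_all
    then have "y + y' = (x + x') \<star> a" using * k AB by (simp add: td_add_left add_ac)
    then show ?thesis by (simp add: g_def l add.assoc)
  next
    fix a a' assume l: "l = vert_line a" and k: "k = vert_line a'"
    then have "x = x'" using * AB by simp
    then show ?thesis by (simp add: g_def l)
  qed (use * that AB in \<open>cases P; simp add: g_def\<close>)+
  moreover have "g X = X" if "X \<in> line_infty" for X
    using that by (cases X) (simp_all add: g_def)
  ultimately have "central_collineation L P line_infty g"
    by (simp add: central_collineation_def) (simp add: g_def)
  moreover have "g A = B" by (simp add: g_def AB add_ac)
  ultimately show "\<exists>g. central_collineation L P line_infty g \<and> g A = B" by blast
qed

lemma shear_point_infty: "shear_point L line_infty Ideal_infty"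
  unfolding shear_point_def
proof (intro ballI impI)
  fix l and A B :: "'a point"
  assume *: "l \<in> L" "A \<in> line_infty" "B \<in> line_infty" "Ideal_infty \<in> l" "l \<noteq> line_infty"
    "A \<noteq> Ideal_infty" "B \<noteq> Ideal_infty"
  obtain a where l: "l = vert_line a" using *(1,4,5) by (elim plane_line_cases) auto
  obtain c c' where AB: "A = Ideal c" "B = Ideal c'" using * by (cases A; cases B) auto
  \<comment> \<open>A shear by c + c' whose translation part cancels it on the axis x = a.\<close>
  define g where "g = shear_translation 0 (a \<star> (c + c')) (c + c')"
  have "g X = X" if "X \<in> l" for X using that by (cases X) (simp_all add: g_def l add.assoc)
  moreover have "g ` k = k" if "k \<in> L" "Ideal_infty \<in> k" for k
    using that by (elim plane_line_cases) (simp_all add: g_def)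
  ultimately have "central_collineation L Ideal_infty l g"
    by (simp add: central_collineation_def) (simp add: g_def)
  moreover have "g A = B" by (simp add: g_def AB)
  ultimately show "\<exists>g. central_collineation L Ideal_infty l g \<and> g A = B" by blast
qed

lemma meet_vert_td: "Q \<in> vert_line x \<Longrightarrow> Q \<in> td_line n a b \<Longrightarrow> Q = Aff x (x \<star> a + b)"
  by (cases Q) auto

lemma obtain_two_Tr_0:
  assumes n5: "n \<ge> 5"
  obtains x y where "Tr x = 0" "x \<noteq> 0" "Tr y = 0" "y \<noteq> 0" "x \<noteq> y"
proof -
  let ?H = "{x :: 'a. Tr x = 0}"
  have "32 \<le> (2 :: nat) ^ n" using power_increasing[OF n5, of "2 :: nat"] by simp
  then have H: "card ?H \<ge> 8" using card_two_traces[of 1 1] by simp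
  have *: "\<not> ?H \<subseteq> {0, z}" for z
  proof
    assume "?H \<subseteq> {0, z}"
    then have "card ?H \<le> card {0, z}" by (intro card_mono) auto
    also have "\<dots> \<le> 2" by (simp add: card_insert_if)
    finally show False using H by simp
  qed
  obtain x where x: "x \<in> ?H" "x \<noteq> 0" using *[of 0] by auto
  moreover obtain y where "y \<in> ?H" "y \<noteq> 0" "x \<noteq> y" using *[of x] by auto
  ultimately show ?thesis by (intro that[of x y]) auto
qed

text \<open>Take an elation with axis x = 0 and centre (0, 0) that maps (x, 0) to (y, 0), where x
  and y are distinct, nonzero and of trace zero. The image of the line at infinity contains the
  fixed point (\<infinity>), so it is the line at infinity or a vertical line.\<close>

lemma vert_line_not_translation_line:
  assumes n5: "n \<ge> 5"
  shows "\<not> translation_line L (vert_line 0 :: 'a point set)"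
proof
  assume tr: "translation_line L (vert_line 0 :: 'a point set)"
  obtain x y where x: "Tr x = 0" "x \<noteq> 0" and y: "Tr y = 0" "y \<noteq> 0" and "x \<noteq> y"
    using obtain_two_Tr_0[OF n5] by blast
  obtain g where g: "central_collineation L (Aff 0 0) (vert_line 0) g"
    and gx: "g (Aff x 0) = Aff y 0"
    using translation_lineD[OF tr, of "Aff 0 0" "td_line n 0 0" "Aff x 0" "Aff y 0"] x y by auto
  have col: "collineation L g" and fixed: "\<And>X. X \<in> vert_line 0 \<Longrightarrow> g X = X"
    using g by (auto simp: central_collineation_def)
  have pencil: "g ` td_line n a 0 = td_line n a 0" for a
    using g by (auto simp: central_collineation_def)
  have g0 [simp]: "g (Aff 0 b) = Aff 0 b" "g Ideal_infty = Ideal_infty" for b by (simp_all add: fixed)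
  note im = collineation_image[OF col] and mem = collineation_mem[OF col]
  have "g ` vert_line x = vert_line y"
    by (rule line_through_infty[of _ n _ 0])
      (use im mem[of Ideal_infty] mem[of "Aff x 0"] in \<open>auto simp: gx\<close>)
  then have gxa: "g (Aff x (x \<star> a)) = Aff y (y \<star> a)" for a
    using meet_vert_td[of "g (Aff x (x \<star> a))" y a 0] mem[of "Aff x (x \<star> a)" "vert_line x"]
      mem[of "Aff x (x \<star> a)" "td_line n a 0"] by (simp add: pencil)
  have "g ` line_infty \<in> L" "Ideal_infty \<in> g ` line_infty"
    using im mem[of Ideal_infty line_infty] by simp_all
  then show False
  proof (elim plane_line_cases)
    \<comment> \<open>Then (1) is fixed, so the line of slope 1 through (0, x) and (x, 0) is fixed
      as well and would contain (y, 0).\<close>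
    assume inf: "g ` line_infty = line_infty"
    have "g (Ideal 1) = Ideal 1"
      using mem[of "Ideal 1" line_infty] mem[of "Ideal 1" "td_line n 1 0"]
      by (cases "g (Ideal 1)") (simp_all add: inf pencil)
    then have "g ` td_line n 1 x = td_line n 1 (x + 0 \<star> 1)"
      by (intro line_through_slope) (use im mem[of "Ideal 1"] mem[of "Aff 0 x"] in auto)
    then have "Aff y 0 \<in> td_line n 1 x" using mem[of "Aff x 0" "td_line n 1 x"] gx by simp
    then show False using \<open>x \<noteq> y\<close> add_eq_zero_iff[of y x] by auto
  next
    fix u assume u: "g ` line_infty = vert_line u"
    have g_ideal: "g (Ideal a) = Aff u (u \<star> a)" for a
      using meet_vert_td[of "g (Ideal a)" u a 0] mem[of "Ideal a" line_infty]
        mem[of "Ideal a" "td_line n a 0"] by (simp add: u pencil)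
    \<comment> \<open>Follow the line of slope 0 through (0, w): its points (0, w), (x, w) and (0)
      go to (0, w), \<open>(y, y \<star> t)\<close> and (u, 0). Their collinearity, with slope s, is
      the identity.\<close>
    have "u \<star> ((w + Tr (x * w)) / x + (w + Tr (y * w)) / y) = w" for w
    proof -
      define t where "t = (w + Tr (x * w)) / x"
      have t: "x \<star> t = w" unfolding t_def by (rule td_right_inverse[OF x])
      have gxw: "g (Aff x w) = Aff y (y \<star> t)" using gxa[of t] t by simp
      define k where "k = g ` td_line n 0 w"
      have k: "k \<in> L" "Ideal_infty \<notin> k" "Aff 0 w \<in> k" "Aff u 0 \<in> k" "Aff y (y \<star> t) \<in> k"
        unfolding k_def
        using im mem[of Ideal_infty "td_line n 0 w"] mem[of "Aff 0 w" "td_line n 0 w"]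
          mem[of "Ideal 0" "td_line n 0 w"] mem[of "Aff x w" "td_line n 0 w"]
        by (simp_all add: g_ideal gxw)
      obtain s where s: "k = td_line n s w"
        using k(1-3) by (elim plane_line_cases) auto
      have us: "u \<star> s = w" using k(4) by (simp add: s add_eq_zero_iff eq_commute[of 0])
      have "y \<star> (t + s) = w" using k(5) by (simp add: s td_add_right add_ac)
      then have "t + s = (w + Tr (y * w)) / y"
        using td_left_cancel[OF y] td_right_inverse[OF y] by metis
      then have "s = t + (w + Tr (y * w)) / y" by (metis add_self_left)
      then show ?thesis using us by (simp add: t_def)
    qed
    then show False by (rule no_vertical_elation_identity[OF n5 x y \<open>x \<noteq> y\<close>])
  qed simp
qed

text \<open>A vertical image is excluded after a translation to x = 0. If the image is oblique, all
  oblique lines are translation lines, and an elation taking (0, 1) to (\<infinity>) turns one of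
  them into a vertical line.\<close>

lemma collineation_fixes_line_infty:
  assumes n5: "n \<ge> 5" and f: "collineation L f"
  shows "f ` line_infty = line_infty"
proof (rule ccontr)
  assume ne: "f ` line_infty \<noteq> line_infty"
  have no_vert: "\<not> translation_line L (vert_line a)" for a :: 'a
  proof
    assume "translation_line L (vert_line a)"
    from translation_line_image[OF shear_translation_collineation this, of a 0 0]
    show False using vert_line_not_translation_line[OF n5] by simp
  qed
  have tr: "translation_line L (f ` line_infty)"
    using translation_line_image[OF f translation_line_infty] .
  have "f ` line_infty \<in> L" using collineation_image[OF f] by simp
  then obtain a b where ab: "f ` line_infty = td_line n a b"
    using ne no_vert tr by (elim plane_line_cases) auto
  have td: "translation_line L (td_line n c d)" for c d
    using translation_line_image[OF shear_translation_collineation, of "td_line n a b" 0 "b + d" "a + c"] tr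
    by (simp add: ab)
  obtain g where g: "central_collineation L (Aff 0 0) (td_line n 0 0) g"
    and g1: "g (Aff 0 1) = Ideal_infty"
    using translation_lineD[OF td[of 0 0], of "Aff 0 0" "vert_line 0" "Aff 0 1" Ideal_infty] by auto
  have col: "collineation L g" and "g (Aff 1 0) = Aff 1 0"
    using g by (auto simp: central_collineation_def)
  then have "g ` td_line n 1 1 = vert_line 1"
    by (intro line_through_infty[of _ n _ 0])
      (use collineation_image[OF col] collineation_mem[OF col, of "Aff 0 1" "td_line n 1 1"]
        collineation_mem[OF col, of "Aff 1 0" "td_line n 1 1"] g1 in auto)
  then show False using translation_line_image[OF col td[of 1 1]] no_vert by simp
qed

lemma collineation_fixes_Ideal_infty:
  assumes n5: "n \<ge> 5" and f: "collineation L f"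
  shows "f Ideal_infty = Ideal_infty"
proof (rule ccontr)
  assume ne: "f Ideal_infty \<noteq> Ideal_infty"
  have finf: "f ` line_infty = line_infty" by (rule collineation_fixes_line_infty[OF n5 f])
  have "f Ideal_infty \<in> f ` line_infty" by simp
  then obtain c where c: "f Ideal_infty = Ideal c"
    using ne finf by (cases "f Ideal_infty") auto
  \<comment> \<open>The shear by c moves (c) to (0), so (0) inherits the shears that (\<infinity>)
    has.\<close>
  have sp: "shear_point L line_infty (Ideal 0 :: 'a point)"
    using shear_point_image[OF shear_translation_collineation shear_translation_line_infty
        shear_point_image[OF f finf shear_point_infty], of 0 0 c] by (simp add: c)
  obtain g where g: "central_collineation L (Ideal 0) (td_line n 0 0) g"
    and g1: "g Ideal_infty = Ideal 1"
  proof (rule shear_pointD[OF sp, of "td_line n 0 0" Ideal_infty "Ideal 1"])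
    show "td_line n 0 0 \<noteq> (line_infty :: 'a point set)" using mem_lines(3,9) by metis
  qed auto
  have col: "collineation L g" and gx: "g (Aff x 0) = Aff x 0"
    and pencil: "g ` td_line n 0 b = td_line n 0 b" and ginf: "g ` line_infty = line_infty" for x b
    using g by (auto simp: central_collineation_def)
  note im = collineation_image[OF col] and mem = collineation_mem[OF col]
  have vert: "g ` vert_line x = td_line n 1 x" for x
  proof -
    have "g ` vert_line x = td_line n 1 (0 + x \<star> 1)"
      by (rule line_through_slope)
        (use im mem[of Ideal_infty "vert_line x"] mem[of "Aff x 0" "vert_line x"] g1 gx in auto)
    then show ?thesis by simp
  qed
  \<comment> \<open>The image is the intersection of a fixed line of slope 0 with the image of a
    vertical line.\<close>
  have aff: "g (Aff x y) = Aff (x + y) y" for x y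
    using mem[of "Aff x y" "vert_line x"] mem[of "Aff x y" "td_line n 0 y"]
    by (cases "g (Aff x y)") (auto simp: vert pencil add_ac)
  have "\<not> (UNIV :: 'a set) \<subseteq> {0, 1}"
  proof
    assume "(UNIV :: 'a set) \<subseteq> {0, 1}"
    then have "CARD('a) \<le> card {0, 1 :: 'a}" by (intro card_mono) auto
    also have "\<dots> \<le> 2" by simp
    finally show False using power_increasing[OF n5, of "2 :: nat"] by (simp add: card_UNIV)
  qed
  then obtain a :: 'a where a: "a \<noteq> 0" "a \<noteq> 1" by auto
  \<comment> \<open>The image of the line of slope a through the origin cannot be vertical, and a
    slope b for it is ruled out by \<open>no_shear_identity\<close>.\<close>
  have on: "Aff (x + x \<star> a) (x \<star> a) \<in> g ` td_line n a 0" for x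
    using mem[of "Aff x (x \<star> a)" "td_line n a 0"] by (simp add: aff)
  have "g ` td_line n a 0 \<in> L" using im by simp
  then show False
  proof (elim plane_line_cases)
    fix c assume "g ` td_line n a 0 = vert_line c"
    then have eq: "x + x \<star> a = c" for x using on[of x] by simp
    obtain x :: 'a where x: "Tr x = 0" "x \<noteq> 0"
      using obtain_two_Tr_0[OF n5] by blast
    have "x \<star> a = x \<star> 1" using eq[of x] eq[of 0] by (simp add: add_eq_zero_iff)
    then show False using td_left_cancel[OF x] a by blast
  next
    fix b c assume bc: "g ` td_line n a 0 = td_line n b c"
    then have "c = 0" using on[of 0] by simp
    then have "(x + x \<star> a) \<star> b = x \<star> a" for x using on[of x] bc by simp
    then show False by (rule no_shear_identity[OF n5 a])
  qed (use on[of 0] in simp)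
qed

section \<open>Equivalences between the hyperovals\<close>

lemma translation_td_hyperoval:
  "shear_translation (v ^ (2 ^ k) + v) v 0 ` td_hyperoval k = td_hyperoval k"
proof -
  have "p \<in> shear_translation (v ^ (2 ^ k) + v) v 0 ` td_hyperoval k \<longleftrightarrow> p \<in> td_hyperoval k" for p
    by (cases p) (auto simp: shear_translation_image frob_add shift_eq add_ac)
  then show ?thesis by blast
qed

text \<open>With z = y^(2^j) one has y = z^(2^k), so the sheared point (z + y, z) is the point of
  the second hyperoval with parameter z.\<close>

lemma shear_td_hyperoval:
  assumes "n dvd j + k"
  shows "shear_translation 0 0 1 ` td_hyperoval j = td_hyperoval k"
proof -
  have inv: "(y ^ (2 ^ j)) ^ (2 ^ k) = y" "(y ^ (2 ^ k)) ^ (2 ^ j) = y" for y :: 'a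
    using frob_cong[of "j + k" 0 y] assms
    by (simp_all add: cong_0_iff mult.commute flip: power_mult power_add)
  have eq: "x = (y + x) ^ (2 ^ j) + (y + x) \<longleftrightarrow> x = y ^ (2 ^ k) + y" for x y :: 'a
  proof -
    have "x = (y + x) ^ (2 ^ j) + (y + x) \<longleftrightarrow> y = (y + x) ^ (2 ^ j)"
      by (metis add.commute add.left_commute add_self_left)
    also have "\<dots> \<longleftrightarrow> y ^ (2 ^ k) = y + x" by (metis inv)
    also have "\<dots> \<longleftrightarrow> x = y ^ (2 ^ k) + y" by (metis add.commute add_self_left)
    finally show ?thesis .
  qed
  have "p \<in> shear_translation 0 0 1 ` td_hyperoval j \<longleftrightarrow> p \<in> td_hyperoval k" for p
    by (cases p) (auto simp: shear_translation_image eq shift_eq)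
  then show ?thesis by blast
qed

lemma equivalence_fixing_ideal_points:
  assumes n5: "n \<ge> 5" and cop: "coprime n d" "coprime n e"
    and f: "collineation L f" and O: "f ` td_hyperoval d = td_hyperoval e"
    and f0: "f (Ideal 0) = Ideal 0" and f1: "f (Ideal 1) = Ideal 1"
  shows "[d = e] (mod n)"
proof -
  note inf = collineation_fixes_line_infty[OF n5] collineation_fixes_Ideal_infty[OF n5]
  have "f (Aff 0 0) \<in> f ` td_hyperoval d" "f (Aff 0 0) \<notin> f ` line_infty"
    using collineation_mem[OF f] by simp_all
  then obtain v where v: "f (Aff 0 0) = Aff (v ^ (2 ^ e) + v) v"
    by (cases "f (Aff 0 0)") (auto simp: O inf[OF f])
  \<comment> \<open>A translation stabilising the target hyperoval brings the image of the origin
    back to the origin.\<close>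
  define h where "h = shear_translation (v ^ (2 ^ e) + v) v 0 \<circ> f"
  have h: "collineation L h" unfolding h_def
    by (intro collineation_comp shear_translation_collineation f)
  note im = collineation_image[OF h] and mem = collineation_mem[OF h]
  have hO: "h ` td_hyperoval d = td_hyperoval e"
    unfolding h_def image_comp[symmetric] O by (rule translation_td_hyperoval)
  have h0: "h (Aff 0 0) = Aff 0 0" "h (Ideal 0) = Ideal 0" "h (Ideal 1) = Ideal 1"
    by (simp_all add: h_def v f0 f1)
  have "\<exists>x'. h ` vert_line x = vert_line x'" for x
  proof -
    have "h ` vert_line x \<in> L" "Ideal_infty \<in> h ` vert_line x" "h ` vert_line x \<noteq> line_infty"
      using im mem[of Ideal_infty "vert_line x"] mem[of "Ideal 0" "vert_line x"] inf(2)[OF h] h0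
      by auto
    then show ?thesis by (elim plane_line_cases) auto
  qed
  then obtain \<alpha> where \<alpha>: "\<And>x. h ` vert_line x = vert_line (\<alpha> x)" by metis
  have "\<exists>b'. h ` td_line n 0 b = td_line n 0 b'" for b
  proof -
    have "h ` td_line n 0 b \<in> L" "Ideal 0 \<in> h ` td_line n 0 b" "h ` td_line n 0 b \<noteq> line_infty"
      using im mem[of Ideal_infty "td_line n 0 b"] mem[of "Ideal 0" "td_line n 0 b"] inf(2)[OF h] h0
      by auto
    then show ?thesis by (elim plane_line_cases) auto
  qed
  then obtain \<beta> where \<beta>: "\<And>b. h ` td_line n 0 b = td_line n 0 (\<beta> b)" by metis
  have aff: "h (Aff x y) = Aff (\<alpha> x) (\<beta> y)" for x y
    using mem[of "Aff x y" "vert_line x"] mem[of "Aff x y" "td_line n 0 y"]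
    by (cases "h (Aff x y)") (auto simp: \<alpha> \<beta>)
  have \<alpha>0: "\<alpha> 0 = 0" and \<beta>0: "\<beta> 0 = 0" using h0 aff[of 0 0] by simp_all
  have "\<exists>c. h (Ideal a) = Ideal c" for a
    using mem[of "Ideal a" line_infty] mem[of "Ideal a" "{Ideal_infty}"] inf(1)[OF h] inf(2)[OF h]
    by (cases "h (Ideal a)") auto
  then obtain N where N: "\<And>a. h (Ideal a) = Ideal (N a)" by metis
  have line: "\<beta> (x \<star> a + b) = \<alpha> x \<star> N a + \<beta> b" for x a b
  proof -
    have "h ` td_line n a b = td_line n (N a) (\<beta> b + 0 \<star> N a)"
      by (rule line_through_slope)
        (use im mem[of "Ideal a" "td_line n a b"] mem[of "Aff 0 b" "td_line n a b"] in
          \<open>simp_all add: aff \<alpha>0 N\<close>)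
    then show ?thesis using mem[of "Aff x (x \<star> a + b)" "td_line n a b"] by (simp add: aff)
  qed
  have N1: "N 1 = 1" using N[of 1] h0 by simp
  \<comment> \<open>The slope 1 is fixed and \<open>x \<star> 1 = x\<close>, so both coordinates are
    transformed by the same map.\<close>
  have \<alpha>\<beta>: "\<alpha> = \<beta>" using line[of _ 1 0] by (simp add: N1 \<beta>0 fun_eq_iff)
  show ?thesis
  proof (rule autotopism_exponents[OF n5 cop])
    show "\<beta> (x + y) = \<beta> x + \<beta> y" for x y using line[of x 1 y] by (simp add: N1 \<alpha>\<beta>)
    then have \<beta>_add: "\<And>x y. \<beta> (x + y) = \<beta> x + \<beta> y" .
    show "\<beta> (x \<star> a) = \<beta> x \<star> N a" for x a using line[of x a 0] by (simp add: \<beta>0 \<alpha>\<beta>)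
    show "inj \<beta>"
    proof (rule injI)
      fix x y assume "\<beta> x = \<beta> y"
      then have "h (Aff 0 x) = h (Aff 0 y)" by (simp add: aff)
      then show "x = y" using collineation_bij[OF h] by (auto dest: bij_is_inj injD)
    qed
    \<comment> \<open>The image of a hyperoval point lies on the target hyperoval; by additivity the
      summand \<beta> y cancels.\<close>
    show "\<beta> (y ^ (2 ^ d)) = \<beta> y ^ (2 ^ e)" for y
      using mem[of "Aff (y ^ (2 ^ d) + y) y" "td_hyperoval d"]
      by (simp add: aff hO \<alpha>\<beta> \<beta>_add)
  qed
qed

lemma equivalent_imp_cong:
  assumes n5: "n \<ge> 5" and cop: "coprime n d" "coprime n e"
    and equiv: "equivalent_in L (td_hyperoval d) (td_hyperoval e)"
  shows "[d = e] (mod n) \<or> n dvd d + e"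
proof -
  obtain f where f: "collineation L f" and O: "f ` td_hyperoval d = td_hyperoval e"
    using equiv by (auto simp: equivalent_in_def)
  note mem = collineation_mem[OF f]
  have ideal: "f (Ideal c) = Ideal 0 \<or> f (Ideal c) = Ideal 1" if "c = 0 \<or> c = 1" for c
    using that mem[of "Ideal c" "td_hyperoval d"] mem[of "Ideal c" line_infty]
      collineation_fixes_line_infty[OF n5 f]
    by (cases "f (Ideal c)") (auto simp: O)
  have "f (Ideal 0) \<noteq> f (Ideal 1)"
    using collineation_bij[OF f] by (simp add: bij_is_inj inj_eq)
  then consider "f (Ideal 0) = Ideal 0" "f (Ideal 1) = Ideal 1"
    | "f (Ideal 0) = Ideal 1" "f (Ideal 1) = Ideal 0"
    using ideal[of 0] ideal[of 1] by auto
  then show ?thesis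
  proof cases
    case 1
    then show ?thesis using equivalence_fixing_ideal_points[OF n5 cop f O] by simp
  next
    case 2
    \<comment> \<open>e' represents -e modulo n as a natural number. Composing f with the shear by 1
      undoes the swap of (0) and (1) and replaces e by e'.\<close>
    define e' where "e' = e * (n - 1)"
    have "e + e' = n * e" unfolding e'_def using n_pos by (cases n) (simp_all add: algebra_simps)
    then have e': "n dvd e + e'" by simp
    have "coprime n (n - 1)" using coprime_diff_one_left_nat[OF n_pos] by (simp add: coprime_commute)
    then have "coprime n e'" using cop by (simp add: e'_def)
    then have "[d = e'] (mod n)"
    proof (rule equivalence_fixing_ideal_points[OF n5 cop(1)])
      show "collineation L (shear_translation 0 0 1 \<circ> f)"
        by (intro collineation_comp shear_translation_collineation f)
      show "(shear_translation 0 0 1 \<circ> f) ` td_hyperoval d = td_hyperoval e'"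
        unfolding image_comp[symmetric] O by (rule shear_td_hyperoval[OF e'])
    qed (simp_all add: 2)
    then have "[d + e = e' + e] (mod n)" by (rule cong_add) simp
    then have "n dvd d + e" using e' by (metis add.commute cong_dvd_iff)
    then show ?thesis ..
  qed
qed

lemma cong_imp_equivalent:
  assumes "[d = e] (mod n) \<or> n dvd d + e"
  shows "equivalent_in L (td_hyperoval d) (td_hyperoval e)"
  using assms
proof
  assume "[d = e] (mod n)"
  then have "(td_hyperoval d :: 'a point set) = td_hyperoval e"
    unfolding td_hyperoval_def by (simp add: frob_cong)
  moreover have "collineation L id" by (simp add: collineation_def)
  ultimately show ?thesis unfolding equivalent_in_def by (metis image_id id_apply)
next
  assume "n dvd d + e"
  then show ?thesis
    unfolding equivalent_in_def using shear_td_hyperoval shear_translation_collineation by blast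
qed

subsection \<open>The hyperovals\<close>

lemma line_meets_td_hyperoval:
  assumes cop: "coprime n k" and l: "l \<in> L"
  shows "\<exists>A B. td_hyperoval k \<inter> l \<subseteq> {A, B}"
  using l
proof (elim plane_line_cases)
  assume l: "l = line_infty"
  have "p \<in> td_hyperoval k \<inter> l \<Longrightarrow> p \<in> {Ideal 0, Ideal 1}" for p
    by (cases p) (auto simp: l)
  then show ?thesis by blast
next
  fix a assume l: "l = vert_line a"
  show ?thesis
  proof (cases "\<exists>y. y ^ (2 ^ k) + y = a")
    case True
    then obtain y where y: "y ^ (2 ^ k) + y = a" by auto
    have "p \<in> {Aff a y, Aff a (y + 1)}" if "p \<in> td_hyperoval k \<inter> l" for p
    proof (cases p)
      case (Aff x z)
      then have xz: "x = a" "x = z ^ (2 ^ k) + z" using that by (auto simp: l)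
      then have z: "z ^ (2 ^ k) + z = y ^ (2 ^ k) + y" using y by simp
      then have "(y + z) ^ (2 ^ k) = y + z" using add_exchange[OF z] by (simp add: frob_add add_ac)
      then have "y + z = 0 \<or> y + z = 1" by (rule frob_fixed[OF cop])
      then have "z = y \<or> z = y + 1" by (metis add_self_left add.right_neutral)
      then show ?thesis using xz Aff by auto
    qed (use that in \<open>simp_all add: l\<close>)
    then show ?thesis by blast
  next
    case False
    then have "p \<notin> td_hyperoval k \<inter> l" for p by (cases p) (auto simp: l)
    then show ?thesis by blast
  qed
next
  fix a b assume l: "l = td_line n a b"
  \<comment> \<open>Subtracting the point with parameter w moves the line to the origin, where
    \<open>secant_unique\<close> applies to y + w and z + w.\<close>
  have secant: "z = y" if "y \<noteq> w" "z \<noteq> w" and on: "y = (y ^ (2 ^ k) + y) \<star> a + b"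
    "z = (z ^ (2 ^ k) + z) \<star> a + b" "w = (w ^ (2 ^ k) + w) \<star> a + b" for y z w
  proof -
    have sum: "u + w = ((u + w) ^ (2 ^ k) + (u + w)) \<star> a" if "u = (u ^ (2 ^ k) + u) \<star> a + b" for u
    proof -
      have "u + w = ((u ^ (2 ^ k) + u) \<star> a + b) + ((w ^ (2 ^ k) + w) \<star> a + b)"
        using that on(3) by simp
      also have "\<dots> = ((u + w) ^ (2 ^ k) + (u + w)) \<star> a"
        by (simp add: frob_add td_add_left add_ac)
      finally show ?thesis .
    qed
    have "z + w = y + w"
      using secant_unique[OF cop sum[OF on(2)] _ sum[OF on(1)]] that(1,2) by (simp add: add_eq_zero_iff)
    then show ?thesis by simp
  qed
  consider "a = 0" | "a = 1" | "a \<noteq> 0" "a \<noteq> 1" by auto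
  then show ?thesis
  proof cases
    case 1
    have "p \<in> td_hyperoval k \<inter> l \<Longrightarrow> p \<in> {Ideal 0, Aff (b ^ (2 ^ k) + b) b}" for p
      by (cases p) (auto simp: l 1)
    then show ?thesis by blast
  next
    case 2
    \<comment> \<open>For slope 1 the line equation becomes y^(2^k) = b. The exponent k (n - 1)
      gives the unique root, since adding k yields a multiple of n.\<close>
    define y where "y = b ^ (2 ^ (k * (n - 1)))"
    have "k * (n - 1) + k = k * n" using n_pos by (cases n) simp_all
    then have "y ^ (2 ^ k) = b ^ (2 ^ (k * n))"
      unfolding y_def by (simp flip: power_mult power_add)
    also have "\<dots> = b" using frob_cong[of "k * n" 0 b] by (simp add: cong_0_iff)
    finally have y: "y ^ (2 ^ k) = b" .
    have "p \<in> {Ideal 1, Aff (b + y) y}" if p: "p \<in> td_hyperoval k \<inter> l" for p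
    proof (cases p)
      case (Aff x z)
      then have "Aff x z \<in> td_hyperoval k" "Aff x z \<in> td_line n 1 b"
        using p unfolding l 2 by (simp_all only: Int_iff)
      then have xz: "x = z ^ (2 ^ k) + z" "z = x + b"
        by (simp_all only: mem_td_hyperoval mem_lines td_1_right)
      have xb: "x = b + z" by (subst xz(2)) (simp add: add_ac)
      then have "z ^ (2 ^ k) + z = b + z" by (simp only: flip: xz(1))
      then have "z ^ (2 ^ k) = y ^ (2 ^ k)" by (simp only: y add_right_cancel)
      then have "z = y" by (simp only: frob_inject)
      then show ?thesis by (simp add: Aff xb)
    qed (use p in \<open>simp_all add: l 2\<close>)
    then show ?thesis by blast
  next
    case 3
    have aff: "\<exists>y. p = Aff (y ^ (2 ^ k) + y) y \<and> y = (y ^ (2 ^ k) + y) \<star> a + b"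
      if p: "p \<in> td_hyperoval k \<inter> l" for p
    proof (cases p)
      case (Aff x y)
      have x: "x = y ^ (2 ^ k) + y" and y: "y = x \<star> a + b"
        using p unfolding l Aff Int_iff mem_td_hyperoval mem_lines by blast+
      show ?thesis using Aff y unfolding x by blast
    qed (use p 3 in \<open>simp_all add: l\<close>)
    show ?thesis
    proof (cases "\<exists>A B. A \<in> td_hyperoval k \<inter> l \<and> B \<in> td_hyperoval k \<inter> l \<and> A \<noteq> B")
      case True
      then obtain A B where AB: "A \<in> td_hyperoval k \<inter> l" "B \<in> td_hyperoval k \<inter> l" "A \<noteq> B" by blast
      have "p \<in> {A, B}" if "p \<in> td_hyperoval k \<inter> l" for p
        using secant aff[OF that] aff[OF AB(1)] aff[OF AB(2)] AB(3) by (metis insertCI)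
      then show ?thesis by blast
    qed blast
  qed
qed

lemma hyperoval_td_hyperoval:
  assumes cop: "coprime n k"
  shows "hyperoval L (2 ^ n) (td_hyperoval k)"
  unfolding hyperoval_def
proof (intro conjI ballI impI notI)
  let ?A = "(\<lambda>y :: 'a. Aff (y ^ (2 ^ k) + y) y) ` UNIV"
  have eq: "td_hyperoval k = ?A \<union> {Ideal 0, Ideal 1}"
    by (auto simp: td_hyperoval_def)
  show "finite (td_hyperoval k :: 'a point set)" by (simp add: eq)
  have "card ?A = 2 ^ n" unfolding card_UNIV[symmetric] by (rule card_image) (auto intro: injI)
  moreover have "card {Ideal 0, Ideal 1 :: 'a point} = 2" by simp
  moreover have "?A \<inter> {Ideal 0, Ideal 1} = {}" by auto
  ultimately show "card (td_hyperoval k :: 'a point set) = 2 ^ n + 2"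
    unfolding eq by (subst card_Un_disjoint) auto
next
  fix x y z :: "'a point"
  assume *: "x \<in> td_hyperoval k" "y \<in> td_hyperoval k" "z \<in> td_hyperoval k"
    "x \<noteq> y \<and> x \<noteq> z \<and> y \<noteq> z" "\<exists>l\<in>L. x \<in> l \<and> y \<in> l \<and> z \<in> l"
  then obtain l where l: "l \<in> L" "x \<in> l" "y \<in> l" "z \<in> l" by auto
  obtain A B where "td_hyperoval k \<inter> l \<subseteq> {A, B}" using line_meets_td_hyperoval[OF cop l(1)] by blast
  then show False using * l by blast
qed

end

theorem theorem4p2:
  fixes n d e :: nat
  assumes "odd n" and "d > 0" and "e > 0"
    and "gcd n d = 1" and "gcd n e = 1"
    and "CARD('a::{field, finite}) = 2 ^ n"
  shows "hyperoval (td_plane_lines n) (2 ^ n) (td_hyperoval d :: 'a point set)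
    \<and> hyperoval (td_plane_lines n) (2 ^ n) (td_hyperoval e :: 'a point set)
    \<and> (equivalent_in (td_plane_lines n) (td_hyperoval d :: 'a point set) (td_hyperoval e)
       \<longleftrightarrow> [int d = int e] (mod int n) \<or> [int d = - int e] (mod int n))"
proof -
  interpret odd_binary_field n "TYPE('a)"
    using assms by unfold_locales
  have cop: "coprime n d" "coprime n e" using assms by (simp_all add: coprime_iff_gcd_eq_1)
  have "[int d = - int e] (mod int n) \<longleftrightarrow> int n dvd int (d + e)"
    by (simp add: cong_iff_dvd_diff)
  then have rhs: "[int d = int e] (mod int n) \<or> [int d = - int e] (mod int n)
      \<longleftrightarrow> [d = e] (mod n) \<or> n dvd d + e"
    by (simp only: cong_int_iff int_dvd_int_iff)
  \<comment> \<open>For n = 1 every congruence holds; for n = 3 both d and e are 1 or -1 modulo 3.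
    So the right side is always true when n < 5.\<close>
  have small: "[d = e] (mod n) \<or> n dvd d + e" if "n < 5"
  proof -
    have "n = 1 \<or> n = 3" using that assms(1) by presburger
    then show ?thesis
    proof
      assume n: "n = 3"
      then have "\<not> 3 dvd d" "\<not> 3 dvd e"
        using cop coprime_absorb_left[of 3 d] coprime_absorb_left[of 3 e] by auto
      then show ?thesis unfolding n cong_def by presburger
    qed simp
  qed
  show ?thesis
    unfolding rhs
    using hyperoval_td_hyperoval[OF cop(1)] hyperoval_td_hyperoval[OF cop(2)]
      equivalent_imp_cong[OF _ cop] cong_imp_equivalent[of d e] small by fastforce
qed

end
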